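(* Assume that $F,F_1,F_2\in\mathcal{F}_{\mathrm{dist}}$ and $t\ge1$ is real. Then \[ F^{\boxplus t},\quad F_1\boxplus F_2,\quad F_2\circ F_1\in\mathcal{F}_{\mathrm{dist}}. \] In particular, $(\mathcal{F}_{\mathrm{dist}},\boxplus,w)$ and $(\mathcal{F}_{\mathrm{dist}},\circ,w)$ are unital semigroups (with unit the function $F(w)=w$).
   Context: $\mathcal{F}$ is the set of rational functions $F(w)=wP(w)/Q(w)$, where $P,Q\in\mathbb{R}[w]$ are relatively prime polynomials with $P(0)=Q(0)=1$. For $F\in\mathcal{F}$ let $D(z)=z\sum_{n\ge0}s_n(F)z^n$ be the compositional inverse of $F$ near $0$ (so $F(D(z))=z$, $D(0)=0$, $s_0(F)=1$). $\mathcal{F}_{\mathrm{dist}}$ is the set of $F\in\mathcal{F}$ such that $(s_n(F))_{n\ge0}$ is positive definite, i.e. there is a probability distribution $\mu$ on $\mathbb{R}$ with $s_n(F)=\int_{\mathbb{R}}x^n\,\mu(dx)$ for all $n\ge 0$. The $R$-transform of $F\in\mathcal{F}$ is $R(w)=\frac{w}{F(w)}-1$, so $F(w)=\frac{w}{1+R(w)}$. For $F,F_1,F_2\in\mathcal{F}$ with $R$-transforms $R,R_1,R_2$ and $t\in\mathbb{R}$, $F^{\boxplus t}$ and $F_1\boxplus F_2$ are the elements of $\mathcal{F}$ with $R$-transforms $t\cdot R(w)$ and $R_1(w)+R_2(w)$ respectively, i.e. $F^{\boxplus t}(w)=\frac{w}{1+tR(w)}$ and $(F_1\boxplus F_2)(w)=\frac{w}{1+R_1(w)+R_2(w)}$;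 and $(F_2\circ F_1)(w)=F_2(F_1(w))$. *)

theory Defs
  imports
    "HOL-Probability.Probability"
    "HOL-Computational_Algebra.Computational_Algebra"
    "HOL-Computational_Algebra.Field_as_Ring"
    "HOL-Algebra.Group"
begin

text \<open>
  Rational functions with real coefficients are elements of the field of fractions
  of the real polynomials, so equality is equality of rational functions and no values
  at poles are involved.
\<close>

type_synonym ratfun = "real poly fract"

definition rf_const :: "real \<Rightarrow> ratfun" where
  "rf_const c = to_fract [:c:]"

definition rf_X :: ratfun where
  "rf_X = to_fract [:0, 1:]"

definition rf_eval_poly :: "real poly \<Rightarrow> ratfun \<Rightarrow> ratfun" where
  "rf_eval_poly p G = poly (map_poly rf_const p) G"

text \<open>
  The substitution \<open>w \<mapsto> F(G(w))\<close>. The value is meaningful only if the reduced denominator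
  of \<open>F\<close> does not vanish at \<open>G\<close>, which is automatic for nonconstant \<open>G\<close>.
\<close>

definition rf_compose :: "ratfun \<Rightarrow> ratfun \<Rightarrow> ratfun" where
  "rf_compose F G =
     rf_eval_poly (fst (quot_of_fract F)) G / rf_eval_poly (snd (quot_of_fract F)) G"

text \<open>
  The Taylor series at \<open>0\<close>, for rational functions without a pole there
  (the denominator of \<open>quot_of_fract\<close> is in lowest terms).
\<close>

definition rf_taylor :: "ratfun \<Rightarrow> real fps" where
  "rf_taylor F = fps_of_poly (fst (quot_of_fract F)) / fps_of_poly (snd (quot_of_fract F))"

definition F_class :: "ratfun set" where
  "F_class = {rf_X * to_fract P / to_fract Q | P Q :: real poly.
                coprime P Q \<and> poly P 0 = 1 \<and> poly Q 0 = 1}"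

text \<open>
  \<open>fps_inv\<close> is the compositional inverse, here \<open>D(z) = z * (\<Sum>n. s n * z^n)\<close>.
\<close>

definition moment_seq :: "ratfun \<Rightarrow> nat \<Rightarrow> real" where
  "moment_seq F n = fps_nth (fps_inv (rf_taylor F)) (Suc n)"

definition positive_definite_seq :: "(nat \<Rightarrow> real) \<Rightarrow> bool" where
  "positive_definite_seq s \<longleftrightarrow>
     (\<exists>\<mu> :: real measure. real_distribution \<mu> \<and>
        (\<forall>n. has_bochner_integral \<mu> (\<lambda>x. x ^ n) (s n)))"

definition F_dist :: "ratfun set" where
  "F_dist = {F \<in> F_class. positive_definite_seq (moment_seq F)}"

definition R_transform :: "ratfun \<Rightarrow> ratfun" where
  "R_transform F = rf_X / F - 1"

definition free_power :: "ratfun \<Rightarrow> real \<Rightarrow> ratfun" where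
  "free_power F t = rf_X / (1 + rf_const t * R_transform F)"

definition free_add :: "ratfun \<Rightarrow> ratfun \<Rightarrow> ratfun" where
  "free_add F\<^sub>1 F\<^sub>2 = rf_X / (1 + R_transform F\<^sub>1 + R_transform F\<^sub>2)"

end

theory Submission
  imports Defs
begin

unbundle no vec_syntax

text \<open>
  Write the compositional inverse of \<open>F\<close> as \<open>D(z) = z * S(z)\<close> and \<open>1 / S = 1 - b * z - z\<^sup>2 * B\<close>. The
  Hankel form of \<open>S\<close> of order \<open>N + 1\<close> is congruent to the direct sum of \<open>1\<close> and the Hankel form of
  \<open>B\<close> of order \<open>N\<close>, so positivity passes from \<open>S\<close> to \<open>B\<close> and back, with a shift of the order.
  The inverse of \<open>F\<^sub>2 \<circ> F\<^sub>1\<close> is \<open>D\<^sub>1 \<circ> D\<^sub>2\<close>, and \<open>1 / (D\<^sub>1 \<circ> D\<^sub>2) = 1 / D\<^sub>2 - E\<^sub>1 \<circ> D\<^sub>2\<close> with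
  \<open>E\<^sub>1 = b\<^sub>1 + z * B\<^sub>1\<close>; hence positivity of the composition follows by induction on the order.
  The inverse of a free convolution is \<open>D\<^sub>1 \<circ> \<omega>\<^sub>1\<close>, where the subordination functions solve
  \<open>1 / \<omega>\<^sub>1 = 1 / z - E\<^sub>2 \<circ> \<omega>\<^sub>2\<close> and \<open>1 / \<omega>\<^sub>2 = 1 / z - E\<^sub>1 \<circ> \<omega>\<^sub>1\<close>; for a free power it is
  \<open>D \<circ> \<omega>\<close> with \<open>1 / \<omega> = 1 / z - (t - 1) * (E \<circ> \<omega>)\<close>. Again induction on the order applies.
  Since \<open>F\<close> is rational, \<open>S\<close> has exponentially bounded coefficients, so a positive Hankel form yields a
  measure by the moment problem on a compact interval, solved with Bernstein polynomials and
  Helly's selection theorem.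
\<close>

section \<open>Positive semidefinite Hankel forms\<close>

text \<open>Positivity of the Hankel matrix of size \<open>N + 1\<close>. The order is explicit
  because the main arguments are inductions that gain one order per step.\<close>

definition psd_upto :: "nat \<Rightarrow> real fps \<Rightarrow> bool" where
  "psd_upto N f \<longleftrightarrow> (\<forall>a. 0 \<le> (\<Sum>i\<le>N. \<Sum>j\<le>N. a i * a j * f $ (i + j)))"

definition psd :: "real fps \<Rightarrow> bool" where
  "psd f \<longleftrightarrow> (\<forall>N. psd_upto N f)"

lemma psd_upto_add: "psd_upto N f \<Longrightarrow> psd_upto N g \<Longrightarrow> psd_upto N (f + g)"
  by (simp add: psd_upto_def distrib_left sum.distrib)

lemma psd_upto_scale:
  assumes "psd_upto N f" "0 \<le> c"
  shows "psd_upto N (fps_const c * f)"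
proof -
  have "(\<Sum>i\<le>N. \<Sum>j\<le>N. a i * a j * (fps_const c * f) $ (i + j)) =
        c * (\<Sum>i\<le>N. \<Sum>j\<le>N. a i * a j * f $ (i + j))" for a
    by (simp add: sum_distrib_left algebra_simps)
  with assms show ?thesis
    by (simp add: psd_upto_def)
qed

lemma psd_upto_antimono:
  assumes "psd_upto N f" "M \<le> N"
  shows "psd_upto M f"
  unfolding psd_upto_def
proof
  fix a :: "nat \<Rightarrow> real"
  let ?b = "\<lambda>i. if i \<le> M then a i else 0"
  have sub: "{..M} \<subseteq> {..N}" using assms(2) by auto
  have "0 \<le> (\<Sum>i\<le>N. \<Sum>j\<le>N. ?b i * ?b j * f $ (i + j))"
    using assms(1) by (simp only: psd_upto_def)
  also have "\<dots> = (\<Sum>i\<le>M. \<Sum>j\<le>M. ?b i * ?b j * f $ (i + j))"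
    using sub by (intro sum.mono_neutral_cong_right ballI sum.neutral) auto
  also have "\<dots> = (\<Sum>i\<le>M. \<Sum>j\<le>M. a i * a j * f $ (i + j))"
    by simp
  finally show "0 \<le> (\<Sum>i\<le>M. \<Sum>j\<le>M. a i * a j * f $ (i + j))" .
qed

lemma psd_upto_0: "psd_upto 0 f \<longleftrightarrow> 0 \<le> f $ 0"
proof
  assume "psd_upto 0 f"
  then have "0 \<le> (\<Sum>i\<le>0. \<Sum>j\<le>0. (1::real) * 1 * f $ (i + j))"
    unfolding psd_upto_def by (elim allE[of _ "\<lambda>_. 1"])
  then show "0 \<le> f $ 0" by simp
qed (auto simp: psd_upto_def)

lemma psd_even_nonneg:
  assumes "psd f"
  shows "0 \<le> f $ (n + n)"
proof -
  have delta: "(\<Sum>j\<le>n. of_bool (j = n) * h j) = h n" for h :: "nat \<Rightarrow> real"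
    by (simp add: of_bool_def if_distrib[of "\<lambda>x. x * _"] cong: if_cong)
  have "0 \<le> (\<Sum>i\<le>n. \<Sum>j\<le>n. of_bool (i = n) * of_bool (j = n) * f $ (i + j))"
    using assms[unfolded psd_def psd_upto_def, rule_format, of "\<lambda>i. of_bool (i = n)" n] by simp
  also have "\<dots> = f $ (n + n)"
    unfolding mult.assoc sum_distrib_left[symmetric] delta ..
  finally show ?thesis .
qed

text \<open>This is the 2 x 2 minor at \<open>m\<close> and \<open>n\<close>: the Hankel form is
  tested on vectors supported on these two indices.\<close>

lemma psd_Cauchy_Schwarz:
  assumes "psd f"
  shows "(f $ (m + n))\<^sup>2 \<le> f $ (m + m) * f $ (n + n)"
proof (cases "m = n")
  case True
  then show ?thesis by (simp add: power2_eq_square)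
next
  case False
  define N where "N = max m n"
  have q: "0 \<le> x\<^sup>2 * f $ (m + m) + 2 * x * y * f $ (m + n) + y\<^sup>2 * f $ (n + n)" for x y
  proof -
    define a where "a i = (if i = m then x else if i = n then y else 0)" for i
    have a: "(\<Sum>i\<le>N. a i * g i) = x * g m + y * g n" for g
    proof -
      have "(\<Sum>i\<le>N. a i * g i) = (\<Sum>i\<in>{m,n}. a i * g i)"
        by (rule sum.mono_neutral_right) (auto simp: a_def N_def)
      also have "\<dots> = x * g m + y * g n"
        using False by (simp add: a_def)
      finally show ?thesis .
    qed
    have "0 \<le> (\<Sum>i\<le>N. \<Sum>j\<le>N. a i * a j * f $ (i + j))"
      using assms by (simp only: psd_def psd_upto_def)
    moreover have "(\<Sum>i\<le>N. \<Sum>j\<le>N. a i * a j * f $ (i + j)) = (\<Sum>i\<le>N. a i * (\<Sum>j\<le>N. a j * f $ (i + j)))"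
      by (simp only: sum_distrib_left mult.assoc)
    moreover have "(\<Sum>i\<le>N. a i * (\<Sum>j\<le>N. a j * f $ (i + j))) =
        x * (x * f $ (m + m) + y * f $ (m + n)) + y * (x * f $ (n + m) + y * f $ (n + n))"
      by (simp only: a)
    moreover have "\<dots> = x\<^sup>2 * f $ (m + m) + 2 * x * y * f $ (m + n) + y\<^sup>2 * f $ (n + n)"
      by (simp add: power2_eq_square algebra_simps)
    ultimately show ?thesis
      by (simp only:)
  qed
  show ?thesis
  proof (cases "f $ (n + n) = 0")
    case True
    have "f $ (m + n) = 0"
    proof (rule ccontr)
      assume nz: "f $ (m + n) \<noteq> 0"
      \<comment> \<open>The second coordinate is chosen so that the right side equals -1.\<close>
      have "0 \<le> f $ (m + m) + 2 * (-(f $ (m + m) + 1) / (2 * f $ (m + n))) * f $ (m + n)"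
        using q[of 1 "-(f $ (m + m) + 1) / (2 * f $ (m + n))"] True by simp
      with nz show False by (simp add: field_simps)
    qed
    with True show ?thesis by simp
  next
    case False
    with psd_even_nonneg[OF assms, of n] have pos: "0 < f $ (n + n)" by simp
    \<comment> \<open>The vector with entries \<open>f $ (n + n)\<close> and
      \<open>- f $ (m + n)\<close> turns the form into \<open>f $ (n + n)\<close> times the
      determinant.\<close>
    have "0 \<le> (f $ (n + n))\<^sup>2 * f $ (m + m) + 2 * f $ (n + n) * (- f $ (m + n)) * f $ (m + n)
               + (- f $ (m + n))\<^sup>2 * f $ (n + n)"
      by (rule q)
    also have "\<dots> = f $ (n + n) * (f $ (m + m) * f $ (n + n) - (f $ (m + n))\<^sup>2)"
      by (simp add: power2_eq_square algebra_simps)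
    finally show ?thesis
      using pos by (simp add: zero_le_mult_iff)
  qed
qed

text \<open>Cauchy-Schwarz against index 0. It settles the degenerate case of the composition
  argument.\<close>

lemma psd_eq_0:
  assumes "psd f" "f $ 0 = 0"
  shows "f = 0"
proof (rule fps_ext)
  fix n
  show "f $ n = 0 $ n"
    using psd_Cauchy_Schwarz[OF assms(1), of 0 n] assms(2) by simp
qed

text \<open>In matrix form, the value of c M c^T at a is that of M at c^T a; only the order of
  summation changes.\<close>

lemma quadratic_form_congruence:
  fixes a :: "'a \<Rightarrow> real"
  shows "(\<Sum>i\<in>I. \<Sum>j\<in>I. a i * a j * (\<Sum>k\<in>K. \<Sum>l\<in>K. c i k * c j l * M k l)) =
         (\<Sum>k\<in>K. \<Sum>l\<in>K. (\<Sum>i\<in>I. a i * c i k) * (\<Sum>j\<in>I. a j * c j l) * M k l)"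
proof -
  have "(\<Sum>i\<in>I. \<Sum>j\<in>I. a i * a j * (\<Sum>k\<in>K. \<Sum>l\<in>K. c i k * c j l * M k l)) =
        (\<Sum>i\<in>I. \<Sum>j\<in>I. \<Sum>k\<in>K. \<Sum>l\<in>K. a i * c i k * (a j * c j l) * M k l)"
    by (simp add: sum_distrib_left algebra_simps)
  also have "\<dots> = (\<Sum>i\<in>I. \<Sum>k\<in>K. \<Sum>j\<in>I. \<Sum>l\<in>K. a i * c i k * (a j * c j l) * M k l)"
    by (intro sum.cong refl sum.swap)
  also have "\<dots> = (\<Sum>k\<in>K. \<Sum>i\<in>I. \<Sum>j\<in>I. \<Sum>l\<in>K. a i * c i k * (a j * c j l) * M k l)"
    by (rule sum.swap)
  also have "\<dots> = (\<Sum>k\<in>K. \<Sum>i\<in>I. \<Sum>l\<in>K. \<Sum>j\<in>I. a i * c i k * (a j * c j l) * M k l)"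
    by (intro sum.cong refl sum.swap)
  also have "\<dots> = (\<Sum>k\<in>K. \<Sum>l\<in>K. \<Sum>i\<in>I. \<Sum>j\<in>I. a i * c i k * (a j * c j l) * M k l)"
    by (intro sum.cong refl sum.swap)
  also have "\<dots> = (\<Sum>k\<in>K. \<Sum>l\<in>K. (\<Sum>i\<in>I. a i * c i k) * (\<Sum>j\<in>I. a j * c j l) * M k l)"
    unfolding sum_product by (simp only: sum_distrib_right)
  finally show ?thesis .
qed

text \<open>One step of the continued fraction (J-fraction) expansion: \<open>S = 1 / (1 - b * z - z\<^sup>2 * B)\<close>.\<close>

locale self_energy =
  fixes S B :: "real fps" and b :: real
  assumes S_eq: "S * (1 - fps_X * (fps_const b + fps_X * B)) = 1"
begin

lemma S_0: "S $ 0 = 1"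
  using arg_cong[OF S_eq, of "\<lambda>f. f $ 0"] by simp

lemma S_Suc: "S $ Suc n = b * S $ n + (\<Sum>k<n. S $ (n - Suc k) * B $ k)"
proof -
  have "S = S * (1 - fps_X * (fps_const b + fps_X * B)) + fps_X * (fps_const b * S + fps_X * (B * S))"
    by (simp add: algebra_simps)
  also have "\<dots> = 1 + fps_X * (fps_const b * S + fps_X * (B * S))"
    by (simp only: S_eq)
  finally have "S $ Suc n = (1 + fps_X * (fps_const b * S + fps_X * (B * S))) $ Suc n"
    by (rule arg_cong)
  also have "\<dots> = b * S $ n + (\<Sum>k<n. S $ (n - Suc k) * B $ k)"
    by (cases n) (simp_all add: fps_mult_nth[of B S] atLeast0AtMost lessThan_Suc_atMost mult.commute)
  finally show ?thesis .
qed

text \<open>Entry by entry, the Hankel matrix of \<open>S\<close> is s s^T + C H C^T, where s is the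
  coefficient vector of \<open>S\<close>, H the Hankel matrix of \<open>B\<close> and C the
  triangular matrix \<open>coef\<close> below. The induction moves one unit of the index from
  \<open>i\<close> to \<open>j\<close> and expands with \<open>S_Suc\<close>.\<close>

lemma S_add: "S $ (i + j) = S $ i * S $ j
    + (\<Sum>k<i. \<Sum>l<j. S $ (i - Suc k) * S $ (j - Suc l) * B $ (k + l))"
proof (induction i arbitrary: j)
  case 0
  then show ?case by (simp add: S_0)
next
  case (Suc i)
  let ?s = "\<lambda>k. S $ (i - Suc k)" and ?t = "\<lambda>l. S $ (j - Suc l)"
  let ?r = "\<Sum>k<i. \<Sum>l<j. ?s k * ?t l * B $ (Suc (k + l))"
  have "S $ (Suc i + j) = S $ (i + Suc j)" by simp
  also have "\<dots> = S $ i * S $ Suc j + (\<Sum>k<i. \<Sum>l<Suc j. ?s k * S $ (Suc j - Suc l) * B $ (k + l))"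
    by (rule Suc)
  also have "(\<Sum>k<i. \<Sum>l<Suc j. ?s k * S $ (Suc j - Suc l) * B $ (k + l)) =
      (\<Sum>k<i. ?s k * S $ j * B $ k) + ?r"
    by (subst sum.lessThan_Suc_shift) (simp add: sum.distrib)
  also have "S $ i * S $ Suc j = b * S $ i * S $ j + S $ i * (\<Sum>l<j. ?t l * B $ l)"
    by (simp add: S_Suc algebra_simps)
  also have "(\<Sum>k<i. ?s k * S $ j * B $ k) = S $ j * (\<Sum>k<i. ?s k * B $ k)"
    by (simp add: sum_distrib_left algebra_simps)
  finally have 1: "S $ (Suc i + j) = b * S $ i * S $ j + S $ i * (\<Sum>l<j. ?t l * B $ l)
      + (S $ j * (\<Sum>k<i. ?s k * B $ k) + ?r)" .
  have 2: "(\<Sum>k<Suc i. \<Sum>l<j. S $ (Suc i - Suc k) * ?t l * B $ (k + l)) =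
      S $ i * (\<Sum>l<j. ?t l * B $ l) + ?r"
    by (subst sum.lessThan_Suc_shift) (simp add: sum_distrib_left mult.assoc)
  show ?case
    unfolding 1 2 S_Suc[of i] by (simp add: distrib_left distrib_right mult_ac)
qed

text \<open>The triangular Toeplitz matrix of \<open>S\<close> pushed down by one row: row 0
  vanishes and the entries at (k + 1, k) are 1.\<close>

definition coef :: "nat \<Rightarrow> nat \<Rightarrow> real" where
  "coef i k = (if k < i then S $ (i - Suc k) else 0)"

lemma quadratic_form_S:
  "(\<Sum>i\<le>Suc N. \<Sum>j\<le>Suc N. a i * a j * S $ (i + j)) = (\<Sum>i\<le>Suc N. a i * S $ i)\<^sup>2 +
    (\<Sum>k\<le>N. \<Sum>l\<le>N. (\<Sum>i\<le>Suc N. a i * coef i k) * (\<Sum>i\<le>Suc N. a i * coef i l) * B $ (k + l))"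
proof -
  have S: "S $ (i + j) = S $ i * S $ j + (\<Sum>k\<le>N. \<Sum>l\<le>N. coef i k * coef j l * B $ (k + l))"
    if "i \<le> Suc N" "j \<le> Suc N" for i j
  proof -
    have "(\<Sum>k\<le>N. \<Sum>l\<le>N. coef i k * coef j l * B $ (k + l)) =
      (\<Sum>k<i. \<Sum>l<j. S $ (i - Suc k) * S $ (j - Suc l) * B $ (k + l))"
      using that by (intro sum.mono_neutral_cong_right ballI sum.neutral) (auto simp: coef_def)
    then show ?thesis by (simp add: S_add)
  qed
  have "(\<Sum>i\<le>Suc N. \<Sum>j\<le>Suc N. a i * a j * S $ (i + j)) =
     (\<Sum>i\<le>Suc N. \<Sum>j\<le>Suc N. a i * a j * (S $ i * S $ j)) +
     (\<Sum>i\<le>Suc N. \<Sum>j\<le>Suc N. a i * a j * (\<Sum>k\<le>N. \<Sum>l\<le>N. coef i k * coef j l * B $ (k + l)))"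
    unfolding sum.distrib[symmetric] distrib_left[symmetric]
    by (intro sum.cong refl) (simp add: S)
  also have "(\<Sum>i\<le>Suc N. \<Sum>j\<le>Suc N. a i * a j * (S $ i * S $ j)) = (\<Sum>i\<le>Suc N. a i * S $ i)\<^sup>2"
    unfolding power2_eq_square sum_product by (intro sum.cong refl) (simp add: mult_ac)
  finally show ?thesis
    by (simp only: quadratic_form_congruence)
qed

text \<open>In \<open>quadratic_form_S\<close> the first term is a square and the second is the form
  of \<open>B\<close> at a transformed vector.\<close>

lemma psd_upto_S:
  assumes "psd_upto N B"
  shows "psd_upto (Suc N) S"
  unfolding psd_upto_def quadratic_form_S
proof
  fix a :: "nat \<Rightarrow> real"
  let ?c = "\<lambda>k. \<Sum>i\<le>Suc N. a i * coef i k"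
  have "0 \<le> (\<Sum>k\<le>N. \<Sum>l\<le>N. ?c k * ?c l * B $ (k + l))"
    by (rule assms[unfolded psd_upto_def, rule_format])
  then show "0 \<le> (\<Sum>i\<le>Suc N. a i * S $ i)\<^sup>2 + (\<Sum>k\<le>N. \<Sum>l\<le>N. ?c k * ?c l * B $ (k + l))"
    by simp
qed

text \<open>The triangular system expressing \<open>c\<close> through \<open>a\<close> is solved by power series division.\<close>

lemma psd_upto_B:
  assumes "psd_upto (Suc N) S"
  shows "psd_upto N B"
  unfolding psd_upto_def
proof
  fix c :: "nat \<Rightarrow> real"
  \<comment> \<open>The unknown vector, read backwards from index \<open>N + 1\<close>, is sought as
    the coefficients of a series \<open>A\<close>; the system then says that \<open>A * S\<close>
    has the reversed \<open>c\<close> as its coefficients.\<close>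
  define A where "A = Abs_fps (\<lambda>m. c (N - m)) * inverse S"
  have A: "A * S = Abs_fps (\<lambda>m. c (N - m))"
    by (simp add: A_def S_0 mult.assoc inverse_mult_eq_1)
  \<comment> \<open>Row 0 of \<open>coef\<close> vanishes, so \<open>a 0\<close> is free; its value
    makes the squared linear form in \<open>quadratic_form_S\<close> zero.\<close>
  define a where "a i = (if i = 0 then - (\<Sum>i\<le>N. A $ (N - i) * S $ Suc i) else A $ (Suc N - i))" for i
  have 1: "(\<Sum>i\<le>Suc N. a i * S $ i) = 0"
    by (subst sum.atMost_Suc_shift) (simp add: a_def S_0)
  have 2: "(\<Sum>i\<le>Suc N. a i * coef i k) = c k" if "k \<le> N" for k
  proof -
    have "(\<Sum>i\<le>Suc N. a i * coef i k) = (\<Sum>i\<le>N. A $ (N - i) * coef (Suc i) k)"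
      by (subst sum.atMost_Suc_shift) (simp add: a_def coef_def)
    also have "\<dots> = (\<Sum>i\<in>{k..N}. A $ (N - i) * S $ (i - k))"
      by (intro sum.mono_neutral_cong_right) (auto simp: coef_def)
    also have "\<dots> = (\<Sum>m=0..N - k. A $ m * S $ (N - k - m))"
      using that by (intro sum.reindex_bij_witness[of _ "\<lambda>m. N - m" "\<lambda>i. N - i"]) auto
    also have "\<dots> = (A * S) $ (N - k)"
      by (simp add: fps_mult_nth)
    also have "\<dots> = c k"
      using that by (simp add: A)
    finally show ?thesis .
  qed
  have "0 \<le> (\<Sum>i\<le>Suc N. \<Sum>j\<le>Suc N. a i * a j * S $ (i + j))"
    using assms by (simp only: psd_upto_def)
  also have "\<dots> = (\<Sum>k\<le>N. \<Sum>l\<le>N. c k * c l * B $ (k + l))"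
    unfolding quadratic_form_S 1 by (simp add: 2 del: sum.atMost_Suc)
  finally show "0 \<le> (\<Sum>k\<le>N. \<Sum>l\<le>N. c k * c l * B $ (k + l))" .
qed

lemma psd_B: "psd S \<Longrightarrow> psd B"
  using psd_upto_B by (simp add: psd_def)

end

lemma self_energy_exists:
  assumes "S $ 0 = 1"
  obtains b B where "self_energy S B b"
proof -
  define T where "T = inverse S"
  have "S * T = 1"
    using assms by (simp add: T_def inverse_mult_eq_1')
  moreover have "T = 1 - fps_X * (fps_const (- T $ 1) + fps_X * (- fps_shift 2 T))"
  proof (rule fps_ext)
    fix n
    have "T $ 0 = 1"
      using assms by (simp add: T_def)
    then show "T $ n = (1 - fps_X * (fps_const (- T $ 1) + fps_X * (- fps_shift 2 T))) $ n"
      by (cases n rule: nat.exhaust; cases "n - 1") (auto simp: numeral_2_eq_2)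
  qed
  ultimately have "self_energy S (- fps_shift 2 T) (- T $ 1)"
    by (simp add: self_energy_def)
  then show thesis by (rule that)
qed

section \<open>Composition and subordination of Hankel-positive series\<close>

text \<open>Times \<open>fps_X\<close>, the series is \<open>(fps_X * f) oo (fps_X * g)\<close>. Its
  self-energy is \<open>B2 + g * (B1 oo w)\<close>, whose second summand has the same shape one
  order lower. Since \<open>B1\<close> need not have constant term 1, \<open>f\<close> is rescaled
  first; positivity of \<open>f\<close> at all orders makes the case \<open>f $ 0 = 0\<close>
  trivial.\<close>

lemma psd_upto_compose:
  assumes "psd f" "psd_upto N g" "g $ 0 = 1"
  shows "psd_upto N (g * (f oo (fps_X * g)))"
  using assms
proof (induction N arbitrary: f g)
  case 0
  then show ?case
    using psd_even_nonneg[of f 0] by (simp add: psd_upto_0)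
next
  case (Suc N)
  show ?case
  proof (cases "f $ 0 = 0")
    case True
    then have "f = 0" using Suc.prems(1) psd_eq_0 by blast
    then show ?thesis by (simp add: psd_upto_def)
  next
    case False
    define c where "c = f $ 0"
    have c: "c > 0"
      using False psd_even_nonneg[OF Suc.prems(1), of 0] by (simp add: c_def)
    define S where "S = fps_const (inverse c) * f"
    have f: "f = fps_const c * S"
      using c by (simp add: S_def mult.assoc[symmetric])
    have S0: "S $ 0 = 1"
      using c by (simp add: S_def c_def)
    have psdS: "psd S"
      using Suc.prems(1) c unfolding psd_def S_def by (intro allI psd_upto_scale) auto
    obtain b1 B1 where "self_energy S B1 b1"
      using self_energy_exists[OF S0] .
    then interpret S: self_energy S B1 b1 .
    obtain b2 B2 where "self_energy g B2 b2"
      using self_energy_exists[OF Suc.prems(3)] .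
    then interpret g: self_energy g B2 b2 .
    define w where "w = fps_X * g"
    have w0: "w $ 0 = 0" by (simp add: w_def)
    have *: "(S oo w) * (1 - w * (fps_const b1 + w * (B1 oo w))) = 1"
      using arg_cong[OF S.S_eq, of "\<lambda>f. f oo w"] w0
      by (simp add: fps_compose_mult_distrib fps_compose_sub_distrib fps_compose_add_distrib)
    \<comment> \<open>As \<open>w = fps_X * g\<close>, the reciprocal of the product is that of
      \<open>g\<close> minus \<open>fps_X * (fps_const b1 + w * (B1 oo w))\<close>.\<close>
    interpret h: self_energy "g * (S oo w)" "B2 + g * (B1 oo w)" "b1 + b2"
    proof
      have "(g * (S oo w)) * (1 - fps_X * (fps_const (b1 + b2) + fps_X * (B2 + g * (B1 oo w)))) =
        (S oo w) * (g * (1 - fps_X * (fps_const b2 + fps_X * B2)) - w * (fps_const b1 + w * (B1 oo w)))"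
        by (simp add: w_def algebra_simps fps_const_add[symmetric] del: fps_const_add)
      then show "(g * (S oo w)) * (1 - fps_X * (fps_const (b1 + b2) + fps_X * (B2 + g * (B1 oo w)))) = 1"
        by (simp only: g.S_eq *)
    qed
    have "psd_upto (Suc N) (g * (S oo w))"
    proof (intro h.psd_upto_S psd_upto_add g.psd_upto_B)
      show "psd_upto N (g * (B1 oo w))"
        unfolding w_def
        using Suc.prems psdS psd_upto_antimono[of "Suc N" g N] by (intro Suc.IH S.psd_B) auto
    qed (fact Suc.prems)
    then have "psd_upto (Suc N) (fps_const c * (g * (S oo w)))"
      using c by (intro psd_upto_scale) auto
    also have "fps_const c * (g * (S oo w)) = g * (f oo (fps_X * g))"
      by (simp only: f w_def fps_const_mult_apply_left[symmetric] mult.left_commute)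
    finally show ?thesis .
  qed
qed

lemma psd_compose: "psd f \<Longrightarrow> psd g \<Longrightarrow> g $ 0 = 1 \<Longrightarrow> psd (g * (f oo (fps_X * g)))"
  by (simp add: psd_def psd_upto_compose)

lemma compose_self_energy:
  fixes g :: "real fps"
  shows "(fps_const b + fps_X * B) oo (fps_X * g) = fps_const b + fps_X * (g * (B oo (fps_X * g)))"
  by (simp add: fps_compose_add_distrib fps_compose_mult_distrib mult.assoc)

text \<open>The order up to which the two solutions are known to be positive increases by one
  each time that it is fed through the fixed-point equations.\<close>

lemma psd_subordination_add:
  assumes "psd B1" "psd B2" "g1 $ 0 = 1" "g2 $ 0 = 1"
    and 1: "g2 * (1 - fps_X * ((fps_const b1 + fps_X * B1) oo (fps_X * g1))) = 1"
    and 2: "g1 * (1 - fps_X * ((fps_const b2 + fps_X * B2) oo (fps_X * g2))) = 1"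
  shows "psd g1"
proof -
  interpret g2: self_energy g2 "g1 * (B1 oo (fps_X * g1))" b1
    using 1 by unfold_locales (simp add: compose_self_energy)
  interpret g1: self_energy g1 "g2 * (B2 oo (fps_X * g2))" b2
    using 2 by unfold_locales (simp add: compose_self_energy)
  have "psd_upto N g1 \<and> psd_upto N g2" for N
  proof (induction N)
    case 0
    show ?case by (simp add: psd_upto_0 assms)
  next
    case (Suc N)
    then show ?case
      using assms(1-4) by (blast intro: g1.psd_upto_S g2.psd_upto_S psd_upto_compose)
  qed
  then show ?thesis by (simp add: psd_def)
qed

text \<open>The self-energy of \<open>g\<close> is \<open>c\<close> times
  \<open>g * (B oo (fps_X * g))\<close>, so positivity of \<open>g\<close> at order \<open>N\<close>
  yields it at order \<open>N + 1\<close>. For free powers \<open>c\<close> is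
  \<open>t - 1\<close>.\<close>

lemma psd_subordination_power:
  assumes "psd B" "g $ 0 = 1" "0 \<le> c"
    and 1: "g * (1 - fps_X * (fps_const c * ((fps_const b + fps_X * B) oo (fps_X * g)))) = 1"
  shows "psd g"
proof -
  interpret g: self_energy g "fps_const c * (g * (B oo (fps_X * g)))" "c * b"
    using 1[unfolded compose_self_energy] by unfold_locales (simp only: distrib_left fps_const_mult[symmetric] mult_ac)
  have "psd_upto N g" for N
  proof (induction N)
    case 0
    show ?case by (simp add: psd_upto_0 assms)
  next
    case (Suc N)
    then show ?case
      using assms(1-3) by (blast intro: g.psd_upto_S psd_upto_scale psd_upto_compose)
  qed
  then show ?thesis by (simp add: psd_def)
qed

section \<open>Coefficient bounds\<close>

text \<open>The weighted l1 norm of the coefficients at radius \<open>r\<close>, cut off at order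
  \<open>n\<close> so that a bound uniform in \<open>n\<close> can be proved by induction before
  convergence is known.\<close>

definition trunc_norm :: "nat \<Rightarrow> real \<Rightarrow> real fps \<Rightarrow> real" where
  "trunc_norm n r f = (\<Sum>k\<le>n. \<bar>f $ k\<bar> * r ^ k)"

lemma trunc_norm_nonneg: "0 \<le> r \<Longrightarrow> 0 \<le> trunc_norm n r f"
  by (simp add: trunc_norm_def sum_nonneg)

lemma trunc_norm_const: "trunc_norm n r (fps_const c) = \<bar>c\<bar>"
proof -
  have "trunc_norm n r (fps_const c) = (\<Sum>k\<in>{0}. \<bar>fps_const c $ k\<bar> * r ^ k)"
    unfolding trunc_norm_def by (rule sum.mono_neutral_right) auto
  then show ?thesis by simp
qed

lemma trunc_norm_add:
  assumes "0 \<le> r"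
  shows "trunc_norm n r (f + g) \<le> trunc_norm n r f + trunc_norm n r g"
  unfolding trunc_norm_def sum.distrib[symmetric] distrib_right[symmetric]
  using assms by (intro sum_mono mult_right_mono) auto

lemma trunc_norm_diff:
  assumes "0 \<le> r"
  shows "trunc_norm n r (f - g) \<le> trunc_norm n r f + trunc_norm n r g"
  unfolding trunc_norm_def sum.distrib[symmetric] distrib_right[symmetric]
  using assms by (intro sum_mono mult_right_mono) auto

text \<open>Submultiplicativity survives truncation: the pairs with \<open>i + j <= n\<close> lie in
  the square of pairs with both indices at most \<open>n\<close>.\<close>

lemma trunc_norm_mult:
  assumes "0 \<le> r"
  shows "trunc_norm n r (f * g) \<le> trunc_norm n r f * trunc_norm n r g"
proof -
  let ?F = "\<lambda>k. \<bar>f $ k\<bar> * r ^ k" and ?G = "\<lambda>k. \<bar>g $ k\<bar> * r ^ k"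
  have "trunc_norm n r (f * g) \<le> (\<Sum>k\<le>n. \<Sum>i\<le>k. ?F i * ?G (k - i))"
    unfolding trunc_norm_def
  proof (rule sum_mono)
    fix k
    have "\<bar>(f * g) $ k\<bar> \<le> (\<Sum>i\<le>k. \<bar>f $ i\<bar> * \<bar>g $ (k - i)\<bar>)"
      unfolding fps_mult_nth atLeast0AtMost abs_mult[symmetric] by (rule sum_abs)
    then have "\<bar>(f * g) $ k\<bar> * r ^ k \<le> (\<Sum>i\<le>k. \<bar>f $ i\<bar> * \<bar>g $ (k - i)\<bar>) * r ^ k"
      using assms by (simp add: mult_right_mono)
    also have "\<dots> = (\<Sum>i\<le>k. \<bar>f $ i\<bar> * \<bar>g $ (k - i)\<bar> * (r ^ i * r ^ (k - i)))"
      unfolding sum_distrib_right by (intro sum.cong refl) (simp flip: power_add)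
    finally show "\<bar>(f * g) $ k\<bar> * r ^ k \<le> (\<Sum>i\<le>k. ?F i * ?G (k - i))"
      by (simp add: mult_ac)
  qed
  also have "\<dots> = (\<Sum>(i, j)\<in>{(i, j). i + j \<le> n}. ?F i * ?G j)"
    by (subst sum.triangle_reindex_eq) simp
  also have "\<dots> \<le> (\<Sum>(i, j)\<in>{..n} \<times> {..n}. ?F i * ?G j)"
    using assms by (intro sum_mono2) auto
  also have "\<dots> = trunc_norm n r f * trunc_norm n r g"
    by (simp add: trunc_norm_def sum_product sum.cartesian_product)
  finally show ?thesis .
qed

lemma trunc_norm_fps_X_mult: "trunc_norm (Suc n) r (fps_X * f) = r * trunc_norm n r f"
  unfolding trunc_norm_def
  by (subst sum.atMost_Suc_shift) (simp add: sum_distrib_left mult_ac)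

lemma poly_abs_mono:
  assumes "0 \<le> x" "x \<le> y"
  shows "0 \<le> poly (map_poly abs p) x \<and> poly (map_poly abs p) x \<le> poly (map_poly abs p) (y :: real)"
  using assms by (induction p) (auto simp: map_poly_pCons intro!: add_mono mult_mono)

lemma trunc_norm_compose:
  assumes "0 \<le> r" "D $ 0 = 0"
  shows "trunc_norm n r (fps_of_poly p oo D) \<le> poly (map_poly abs p) (trunc_norm n r D)"
proof (induction p)
  case 0
  then show ?case by (simp add: trunc_norm_def)
next
  case (pCons c p)
  have "fps_of_poly (pCons c p) oo D = fps_const c + D * (fps_of_poly p oo D)"
    using assms by (simp add: fps_of_poly_pCons fps_compose_add_distrib fps_compose_mult_distrib mult.commute)
  then have "trunc_norm n r (fps_of_poly (pCons c p) oo D)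
      \<le> \<bar>c\<bar> + trunc_norm n r D * trunc_norm n r (fps_of_poly p oo D)"
    using trunc_norm_add[OF assms(1), of n "fps_const c" "D * (fps_of_poly p oo D)"]
      trunc_norm_mult[OF assms(1), of n D "fps_of_poly p oo D"] by (simp add: trunc_norm_const)
  also have "\<dots> \<le> poly (map_poly abs (pCons c p)) (trunc_norm n r D)"
    using pCons.IH assms by (simp add: map_poly_pCons mult_left_mono trunc_norm_nonneg)
  finally show ?case .
qed

text \<open>The coefficient of \<open>D\<^sup>2 * h\<close> of order \<open>n + 1\<close> only involves those of \<open>D\<close> up to order \<open>n\<close>.\<close>

lemma trunc_norm_square_mult:
  assumes "0 \<le> r" "D $ 0 = 0"
  shows "trunc_norm (Suc n) r (D * D * h) \<le> (trunc_norm n r D)\<^sup>2 * trunc_norm n r h"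
proof -
  define E where "E = fps_shift 1 D"
  have D: "D = fps_X * E"
    using assms(2) by (intro fps_ext) (simp add: E_def)
  show ?thesis
  proof (cases n)
    case 0
    then show ?thesis using assms by (simp add: trunc_norm_def fps_mult_nth)
  next
    case (Suc m)
    have "D * D * h = fps_X * (fps_X * (E * (E * h)))"
      by (simp add: D mult_ac)
    then have "trunc_norm (Suc n) r (D * D * h) = r * (r * trunc_norm m r (E * (E * h)))"
      by (simp only: Suc trunc_norm_fps_X_mult)
    also have "\<dots> \<le> r * (r * (trunc_norm m r E * (trunc_norm m r E * trunc_norm m r h)))"
      using assms(1) order.trans[OF trunc_norm_mult[of r m E "E * h"] mult_left_mono[OF trunc_norm_mult[of r m E h]]]
      by (intro mult_left_mono) (auto simp: trunc_norm_nonneg)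
    also have "\<dots> = (trunc_norm n r D)\<^sup>2 * trunc_norm m r h"
      by (simp add: D Suc trunc_norm_fps_X_mult power2_eq_square)
    also have "\<dots> \<le> (trunc_norm n r D)\<^sup>2 * trunc_norm n r h"
      using assms(1) by (intro mult_left_mono) (auto simp: trunc_norm_def Suc)
    finally show ?thesis .
  qed
qed

text \<open>A majorant argument. The equation is F(D) = z with denominators cleared; it is rewritten
  as a fixed-point equation whose right side at order \<open>n + 1\<close> sees \<open>D\<close>
  only up to order \<open>n\<close>. For small \<open>r\<close> the bound
  \<open>trunc_norm n r D <= x\<close> therefore propagates.\<close>

lemma algebraic_inverse_bound:
  fixes P Q :: "real poly"
  assumes D0: "D $ 0 = 0" and P0: "coeff P 0 = 1"
    and eq: "D * (fps_of_poly P oo D) = fps_X * (fps_of_poly Q oo D)"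
  obtains C M :: real where "0 < M" "\<And>n. \<bar>D $ n\<bar> \<le> C * M ^ n"
proof -
  obtain P' where P: "P = pCons 1 P'"
    using P0 by (cases P) (auto simp: coeff_pCons)
  \<comment> \<open>The choice of \<open>x\<close> makes the term quadratic in D at most
    \<open>x / 2\<close>, and \<open>r\<close> does the same for the term with factor
    \<open>fps_X\<close>.\<close>
  define x where "x = 1 / (2 * (1 + poly (map_poly abs P') 1))"
  define r where "r = x / (2 * (1 + poly (map_poly abs Q) x))"
  have P1: "0 \<le> poly (map_poly abs P') 1"
    using poly_abs_mono[of 1 1] by simp
  then have x: "0 < x" "x \<le> 1"
    by (auto simp: x_def field_simps)
  have Px: "poly (map_poly abs P') x \<le> poly (map_poly abs P') 1"
    using poly_abs_mono[of x 1] x by simp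
  have Qx: "0 \<le> poly (map_poly abs Q) x"
    using poly_abs_mono[of x x] x by simp
  have r: "0 < r"
    using x Qx by (simp add: r_def)
  have le1: "r * poly (map_poly abs Q) x \<le> x / 2"
    using x Qx by (simp add: r_def field_simps)
  have "x * poly (map_poly abs P') x \<le> x * poly (map_poly abs P') 1"
    using Px x by simp
  also have "\<dots> \<le> 1 / 2"
    using P1 by (simp add: x_def field_simps)
  finally have le2: "x\<^sup>2 * poly (map_poly abs P') x \<le> x / 2"
    using mult_left_mono[of "x * poly (map_poly abs P') x" "1/2" x] x by (simp add: power2_eq_square)
  have "D * (fps_of_poly P oo D) = D + D * D * (fps_of_poly P' oo D)"
    using D0 by (simp add: P fps_of_poly_pCons fps_compose_add_distrib fps_compose_mult_distrib algebra_simps)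
  then have D: "D = fps_X * (fps_of_poly Q oo D) - D * D * (fps_of_poly P' oo D)"
    using eq by (metis add_diff_cancel_right')
  have bound: "trunc_norm n r D \<le> x" for n
  proof (induction n)
    case 0
    then show ?case using x by (simp add: trunc_norm_def D0)
  next
    case (Suc n)
    let ?t = "trunc_norm n r"
    have t: "0 \<le> ?t D" using r by (simp add: trunc_norm_nonneg)
    have "trunc_norm (Suc n) r D \<le> trunc_norm (Suc n) r (fps_X * (fps_of_poly Q oo D))
        + trunc_norm (Suc n) r (D * D * (fps_of_poly P' oo D))"
      using trunc_norm_diff[of r "Suc n" "fps_X * (fps_of_poly Q oo D)" "D * D * (fps_of_poly P' oo D)"]
        r by (simp only: D[symmetric] less_imp_le)
    also have "\<dots> \<le> r * ?t (fps_of_poly Q oo D) + (?t D)\<^sup>2 * ?t (fps_of_poly P' oo D)"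
      using r D0 by (intro add_mono trunc_norm_square_mult) (auto simp: trunc_norm_fps_X_mult)
    also have "\<dots> \<le> r * poly (map_poly abs Q) (?t D) + (?t D)\<^sup>2 * poly (map_poly abs P') (?t D)"
      using r D0 by (intro add_mono mult_left_mono trunc_norm_compose) auto
    also have "\<dots> \<le> r * poly (map_poly abs Q) x + x\<^sup>2 * poly (map_poly abs P') x"
      using r t Suc poly_abs_mono[OF t Suc]
      by (intro add_mono mult_left_mono mult_mono power_mono) auto
    also have "\<dots> \<le> x"
      using le1 le2 by simp
    finally show ?case .
  qed
  have "\<bar>D $ n\<bar> \<le> x * (1 / r) ^ n" for n
  proof -
    have "\<bar>D $ n\<bar> * r ^ n \<le> trunc_norm n r D"
      unfolding trunc_norm_def using r
      by (intro member_le_sum[of n "{..n}" "\<lambda>k. \<bar>D $ k\<bar> * r ^ k"]) auto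
    also have "\<dots> \<le> x" by (rule bound)
    finally show ?thesis
      using r by (simp add: field_simps)
  qed
  with r show thesis by (intro that[of "1 / r" x]) auto
qed

text \<open>Iterated Cauchy-Schwarz against index 0 bounds the power 2^k of q = |u_1| / u_0 by
  |u_(2^k)| / u_0; growth at rate \<open>M\<close> then forces q to be at most
  \<open>M\<close>.\<close>

lemma psd_bounded_ratio:
  assumes "psd u" "0 < M" and bd: "\<And>n. \<bar>u $ n\<bar> \<le> C * M ^ n"
  shows "\<bar>u $ 1\<bar> \<le> M * u $ 0"
proof (cases "u $ 0 = 0")
  case True
  then show ?thesis using psd_eq_0[OF assms(1) True] by simp
next
  case False
  then have u0: "0 < u $ 0"
    using psd_even_nonneg[OF assms(1), of 0] by simp
  define q where "q = \<bar>u $ 1\<bar> / u $ 0"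
  have q: "q ^ (2 ^ k) \<le> \<bar>u $ (2 ^ k)\<bar> / u $ 0" for k
  proof (induction k)
    case 0
    then show ?case by (simp add: q_def)
  next
    case (Suc k)
    have "q ^ (2 ^ Suc k) = (q ^ (2 ^ k))\<^sup>2"
      by (simp add: power_mult[symmetric] mult.commute)
    also have "\<dots> \<le> (\<bar>u $ (2 ^ k)\<bar> / u $ 0)\<^sup>2"
      using Suc u0 by (intro power_mono) (auto simp: q_def)
    also have "\<dots> = (u $ (0 + 2 ^ k))\<^sup>2 / (u $ 0)\<^sup>2"
      by (simp add: power_divide)
    also have "\<dots> \<le> u $ (0 + 0) * u $ (2 ^ k + 2 ^ k) / (u $ 0)\<^sup>2"
      by (intro divide_right_mono psd_Cauchy_Schwarz assms) auto
    also have "\<dots> = u $ (2 ^ Suc k) / u $ 0"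
      using u0 by (simp add: power2_eq_square flip: mult_2)
    also have "\<dots> \<le> \<bar>u $ (2 ^ Suc k)\<bar> / u $ 0"
      using u0 by (intro divide_right_mono) auto
    finally show ?case .
  qed
  have "q \<le> M"
  proof (rule ccontr)
    assume "\<not> q \<le> M"
    then have "1 < q / M" using assms(2) by simp
    then obtain n where n: "C / u $ 0 < (q / M) ^ n"
      using real_arch_pow by blast
    also have "\<dots> \<le> (q / M) ^ (2 ^ n)"
      using \<open>1 < q / M\<close> less_exp[of n] by (intro power_increasing) auto
    also have "\<dots> \<le> (\<bar>u $ (2 ^ n)\<bar> / u $ 0) / M ^ (2 ^ n)"
      unfolding power_divide using q[of n] assms(2) by (intro divide_right_mono) auto
    also have "\<dots> \<le> ((C * M ^ (2 ^ n)) / u $ 0) / M ^ (2 ^ n)"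
      using u0 assms(2) by (intro divide_right_mono bd) auto
    also have "\<dots> = C / u $ 0"
      using assms(2) by simp
    finally show False by simp
  qed
  then show ?thesis
    using u0 by (simp add: q_def field_simps)
qed

section \<open>The moment problem\<close>

text \<open>The binomial quotient is the product of (k - i) / (n - i) over i < j, compared factor by
  factor with k / n. The bound on \<open>2 * j\<close> keeps the denominators at least n / 2 and all
  factors at most 1 in absolute value, also for k < i.\<close>

lemma binomial_ratio_approx:
  assumes "k \<le> n" "2 * j \<le> n" "0 < n"
  shows "\<bar>(real k / real n) ^ j - real (k choose j) / real (n choose j)\<bar> \<le> 2 * real j ^ 2 / real n"
proof -
  have ratio: "real (k choose j) / real (n choose j) = (\<Prod>i<j. (real k - real i) / (real n - real i))"
    by (simp add: binomial_gbinomial gbinomial_prod_rev atLeast0LessThan prod_dividef)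
  have "\<bar>(real k / real n) ^ j - real (k choose j) / real (n choose j)\<bar> =
      norm ((\<Prod>i<j. real k / real n) - (\<Prod>i<j. (real k - real i) / (real n - real i)))"
    by (simp add: ratio)
  also have "\<dots> \<le> (\<Sum>i<j. norm (real k / real n - (real k - real i) / (real n - real i)))"
    using assms by (intro norm_prod_diff) (auto simp: field_simps abs_le_iff)
  also have "\<dots> \<le> (\<Sum>i<j. 2 * real j / real n)"
  proof (rule sum_mono)
    fix i assume "i \<in> {..<j}"
    then have i: "i < j" by simp
    then have n: "real n > 0" "real n - real i > 0" "2 * (real n - real i) \<ge> real n"
      using assms by auto
    have eq: "real k / real n - (real k - real i) / (real n - real i) =
        real i * (real n - real k) / (real n * (real n - real i))"
      using n by (simp add: field_simps)
    have "norm (real k / real n - (real k - real i) / (real n - real i)) =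
        real i * (real n - real k) / (real n * (real n - real i))"
      unfolding eq real_norm_def using n assms by (intro abs_of_nonneg divide_nonneg_pos mult_nonneg_nonneg) auto
    also have "\<dots> \<le> real j * real n / (real n * (real n / 2))"
      using n assms i by (intro frac_le mult_mono mult_nonneg_nonneg) auto
    also have "\<dots> = 2 * real j / real n"
      using n by simp
    finally show "norm (real k / real n - (real k - real i) / (real n - real i)) \<le> 2 * real j / real n" .
  qed
  also have "\<dots> = 2 * real j ^ 2 / real n"
    by (simp add: power2_eq_square)
  finally show ?thesis .
qed

section \<open>The Hausdorff moment problem for functionals on polynomials\<close>

lemma poly_eq_sum_X_power: "p = (\<Sum>i\<le>degree p. smult (coeff p i) ([:0, 1:] ^ i))" for p :: "real poly"
  by (simp flip: smult_monom monom_altdef) (simp add: smult_monom poly_as_sum_of_monoms)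

locale linear_functional =
  fixes L :: "real poly \<Rightarrow> real"
  assumes L_add: "L (p + q) = L p + L q" and L_smult: "L (smult c p) = c * L p"
begin

lemma L_0: "L 0 = 0"
  using L_smult[of 0 0] by simp

lemma L_sum: "L (\<Sum>i\<in>A. f i) = (\<Sum>i\<in>A. L (f i))"
  by (induction A rule: infinite_finite_induct) (simp_all add: L_0 L_add)

lemma L_eq_sum_X_power: "L p = (\<Sum>i\<le>degree p. coeff p i * L ([:0, 1:] ^ i))"
proof -
  have "L p = L (\<Sum>i\<le>degree p. smult (coeff p i) ([:0, 1:] ^ i))"
    using poly_eq_sum_X_power[of p] by simp
  then show ?thesis
    by (simp only: L_sum L_smult)
qed

end

text \<open>Hausdorff's condition, positivity on the products of powers of x and 1 - x, suffices for
  \<open>L\<close> to be integration against a probability measure on [0,1].\<close>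

locale hausdorff = linear_functional +
  assumes L_1: "L 1 = 1" and L_nonneg: "0 \<le> L ([:0, 1:] ^ k * [:1, -1:] ^ l)"
begin

text \<open>The value of \<open>L\<close> at a Bernstein basis polynomial, used as the mass of the
  atom k / n.\<close>

definition weight :: "nat \<Rightarrow> nat \<Rightarrow> real" where
  "weight n k = real (n choose k) * L ([:0, 1:] ^ k * [:1, -1:] ^ (n - k))"

lemma weight_nonneg: "0 \<le> weight n k"
  by (simp add: weight_def L_nonneg)

text \<open>By \<open>choose_mult\<close> the sum becomes \<open>L\<close> of X^j times the binomial
  expansion of (X + (1 - X))^(n - j), which is 1.\<close>

lemma sum_weight_binomial:
  assumes "j \<le> n"
  shows "(\<Sum>k\<le>n. weight n k * real (k choose j)) = real (n choose j) * L ([:0, 1:] ^ j)"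
proof -
  let ?X = "[:0, 1:] :: real poly" and ?Y = "[:1, -1:] :: real poly"
  have "(\<Sum>k\<le>n. weight n k * real (k choose j)) = (\<Sum>k\<in>{j..n}. weight n k * real (k choose j))"
    by (rule sum.mono_neutral_right) auto
  also have "\<dots> = (\<Sum>k\<in>{j..n}. real (n choose j) *
      (real ((n - j) choose (k - j)) * L (?X ^ k * ?Y ^ (n - k))))"
  proof (rule sum.cong[OF refl])
    fix k assume "k \<in> {j..n}"
    then have "(n choose k) * (k choose j) = (n choose j) * ((n - j) choose (k - j))"
      by (intro choose_mult) auto
    then have "real (n choose k) * real (k choose j) = real (n choose j) * real ((n - j) choose (k - j))"
      by (metis of_nat_mult)
    then show "weight n k * real (k choose j) =
        real (n choose j) * (real ((n - j) choose (k - j)) * L (?X ^ k * ?Y ^ (n - k)))"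
      by (simp add: weight_def)
  qed
  also have "\<dots> = real (n choose j) *
      (\<Sum>i\<le>n - j. real ((n - j) choose i) * L (?X ^ (i + j) * ?Y ^ (n - j - i)))"
    unfolding sum_distrib_left using assms
    by (intro sum.reindex_bij_witness[of _ "\<lambda>i. i + j" "\<lambda>k. k - j"]) auto
  also have "(\<Sum>i\<le>n - j. real ((n - j) choose i) * L (?X ^ (i + j) * ?Y ^ (n - j - i))) =
      L (?X ^ j * (\<Sum>i\<le>n - j. of_nat ((n - j) choose i) * ?X ^ i * ?Y ^ (n - j - i)))"
    by (simp add: sum_distrib_left L_sum L_smult power_add mult_ac of_nat_poly flip: L_smult)
  also have "(\<Sum>i\<le>n - j. of_nat ((n - j) choose i) * ?X ^ i * ?Y ^ (n - j - i)) = (?X + ?Y) ^ (n - j)"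
    by (rule binomial_ring[symmetric])
  also have "?X + ?Y = 1"
    by (simp add: one_pCons)
  finally show ?thesis by simp
qed

lemma sum_weight: "(\<Sum>k\<le>n. weight n k) = 1"
  using sum_weight_binomial[of 0 n] by (simp add: L_1)

text \<open>Replacing the power of k / n by \<open>(k choose j) / (n choose j)\<close> costs O(1/n),
  and with the latter the sum is exactly the moment.\<close>

lemma sum_weight_power_tendsto: "(\<lambda>n. \<Sum>k\<le>n. weight n k * (real k / real n) ^ j) \<longlonglongrightarrow> L ([:0, 1:] ^ j)"
proof (rule Lim_transform2[OF tendsto_const])
  have "\<forall>\<^sub>F n in sequentially.
      norm (L ([:0, 1:] ^ j) - (\<Sum>k\<le>n. weight n k * (real k / real n) ^ j)) \<le> 2 * real j ^ 2 / real n"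
    using eventually_ge_at_top[of "2 * j"] eventually_gt_at_top[of 0]
  proof eventually_elim
    case (elim n)
    have pos: "real (n choose j) > 0" using elim by simp
    have "L ([:0, 1:] ^ j) = (\<Sum>k\<le>n. weight n k * real (k choose j)) / real (n choose j)"
      using sum_weight_binomial[of j n] elim pos by (simp add: field_simps)
    then have "L ([:0, 1:] ^ j) - (\<Sum>k\<le>n. weight n k * (real k / real n) ^ j) =
        (\<Sum>k\<le>n. weight n k * (real (k choose j) / real (n choose j) - (real k / real n) ^ j))"
      by (simp add: sum_divide_distrib right_diff_distrib sum_subtractf)
    also have "norm \<dots> \<le> (\<Sum>k\<le>n. weight n k * (2 * real j ^ 2 / real n))"
    proof (rule sum_norm_le)
      fix k assume "k \<in> {..n}"
      then show "norm (weight n k * (real (k choose j) / real (n choose j) - (real k / real n) ^ j))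
          \<le> weight n k * (2 * real j ^ 2 / real n)"
        using binomial_ratio_approx[of k n j] elim weight_nonneg[of n k]
        by (simp add: abs_mult abs_minus_commute mult_left_mono del: times_divide_eq_right)
    qed
    also have "\<dots> = 2 * real j ^ 2 / real n"
      unfolding sum_distrib_right[symmetric] sum_weight by simp
    finally show ?case .
  qed
  moreover have "(\<lambda>n. 2 * real j ^ 2 / real n) \<longlonglongrightarrow> 0"
    by (rule lim_const_over_n)
  ultimately show "(\<lambda>n. L ([:0, 1:] ^ j) - (\<Sum>k\<le>n. weight n k * (real k / real n) ^ j)) \<longlonglongrightarrow> 0"
    by (rule Lim_null_comparison)
qed

text \<open>For \<open>n = 0\<close> division by zero yields 0, so the only atom sits at 0 and every
  one of these measures lives on [0,1].\<close>

definition bernstein_measure :: "nat \<Rightarrow> real measure" where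
  "bernstein_measure n = distr (point_measure {..n} (weight n)) borel (\<lambda>k. real k / real n)"

lemma real_distribution_bernstein: "real_distribution (bernstein_measure n)"
proof -
  have "emeasure (point_measure {..n} (weight n)) {..n} = 1"
    by (subst emeasure_point_measure_finite) (simp_all add: weight_nonneg sum_weight sum_ennreal)
  then interpret P: prob_space "point_measure {..n} (weight n)"
    by (intro prob_spaceI) (simp add: space_point_measure)
  show ?thesis
    unfolding bernstein_measure_def
    by (rule P.real_distribution_distr) (simp add: measurable_point_measure_eq1)
qed

lemma integral_bernstein:
  assumes "g \<in> borel_measurable borel"
  shows "integral\<^sup>L (bernstein_measure n) g = (\<Sum>k\<le>n. weight n k * g (real k / real n))"
  unfolding bernstein_measure_def
  using assms by (subst integral_distr)
    (simp_all add: measurable_point_measure_eq1 lebesgue_integral_point_measure_finite weight_nonneg)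

text \<open>The interval is half-open as in the definition of \<open>tight\<close>; the left end -1
  leaves room for an atom at 0.\<close>

lemma measure_bernstein: "measure (bernstein_measure n) {-1<..1} = 1"
proof -
  interpret B: real_distribution "bernstein_measure n" by (rule real_distribution_bernstein)
  have "measure (bernstein_measure n) {-1<..1} = integral\<^sup>L (bernstein_measure n) (indicator {-1<..1})"
    by simp
  also have "\<dots> = (\<Sum>k\<le>n. weight n k * indicator {-1<..1} (real k / real n))"
    by (rule integral_bernstein) simp
  also have "\<dots> = (\<Sum>k\<le>n. weight n k)"
  proof (intro sum.cong refl)
    fix k assume "k \<in> {..n}"
    then have "real k / real n \<le> 1" by (simp add: divide_le_eq)
    moreover have "- 1 < real k / real n"
      by (rule less_le_trans[of _ 0]) auto
    ultimately show "weight n k * indicator {-1<..1} (real k / real n) = weight n k" by simp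
  qed
  finally show ?thesis
    by (simp add: sum_weight)
qed

lemma tight_bernstein: "tight bernstein_measure"
  unfolding tight_def
proof (intro conjI allI impI real_distribution_bernstein)
  fix e :: real assume "0 < e"
  then have "(-1 :: real) < 1 \<and> (\<forall>n. 1 - e < measure (bernstein_measure n) {-1<..1})"
    by (simp add: measure_bernstein)
  then show "\<exists>a b. a < b \<and> (\<forall>n. 1 - e < measure (bernstein_measure n) {a<..b})"
    by blast
qed

text \<open>Helly's theorem gives a weak limit along a subsequence. Weak convergence tests only
  bounded continuous functions, so moments are first computed for powers of the clamp
  \<open>cl\<close>; a second test function shows that the limit lives on [0,1], where
  \<open>cl\<close> is the identity.\<close>

theorem hausdorff_moment_problem:
  obtains \<mu> :: "real measure" where "real_distribution \<mu>"
    "\<And>p. has_bochner_integral \<mu> (poly p) (L p)"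
proof -
  obtain r \<mu> where r: "strict_mono (r :: nat \<Rightarrow> nat)" and \<mu>: "real_distribution \<mu>"
    and "weak_conv_m (bernstein_measure \<circ> id \<circ> r) \<mu>"
    using tight_imp_convergent_subsubsequence[OF tight_bernstein strict_mono_id] by blast
  then have wc: "weak_conv_m (\<lambda>n. bernstein_measure (r n)) \<mu>"
    by (simp add: o_def)
  interpret \<mu>: real_distribution \<mu> by (rule \<mu>)
  define cl where "cl x = max 0 (min 1 x)" for x :: real
  have cl01: "0 \<le> cl x" "cl x \<le> 1" for x by (auto simp: cl_def)
  have contcl: "isCont cl x" for x
    unfolding cl_def by (intro continuous_intros)
  have [measurable]: "cl \<in> borel_measurable borel"
    unfolding cl_def by measurable
  have clk: "cl (real k / real n) = real k / real n" if "k \<le> n" for k n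
  proof -
    have "real k / real n \<le> 1" using that by (simp add: divide_le_eq)
    then show ?thesis by (simp add: cl_def)
  qed
  have lim: "(\<lambda>n. integral\<^sup>L (bernstein_measure (r n)) g) \<longlonglongrightarrow> integral\<^sup>L \<mu> g"
    if "\<And>x. isCont g x" "\<And>x. norm (g x) \<le> 1" for g :: "real \<Rightarrow> real"
    by (rule weak_conv_imp_integral_bdd_continuous_conv
        [where \<mu> = "\<lambda>n. bernstein_measure (r n)", OF real_distribution_bernstein \<mu> wc that])
  have moment_cl: "integral\<^sup>L \<mu> (\<lambda>x. cl x ^ j) = L ([:0, 1:] ^ j)" for j
  proof (rule LIMSEQ_unique)
    show "(\<lambda>n. integral\<^sup>L (bernstein_measure (r n)) (\<lambda>x. cl x ^ j)) \<longlonglongrightarrow> integral\<^sup>L \<mu> (\<lambda>x. cl x ^ j)"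
      using cl01 by (intro lim isCont_power contcl) (auto simp: power_le_one)
    have "integral\<^sup>L (bernstein_measure n) (\<lambda>x. cl x ^ j) = (\<Sum>k\<le>n. weight n k * (real k / real n) ^ j)" for n
      by (subst integral_bernstein) (auto simp: clk)
    then show "(\<lambda>n. integral\<^sup>L (bernstein_measure (r n)) (\<lambda>x. cl x ^ j)) \<longlonglongrightarrow> L ([:0, 1:] ^ j)"
      using LIMSEQ_subseq_LIMSEQ[OF sum_weight_power_tendsto r] by (simp add: o_def)
  qed
  \<comment> \<open>A bounded continuous function that vanishes exactly on [0,1]; all approximating
    measures integrate it to 0.\<close>
  define g where "g x = min 1 \<bar>x - cl x\<bar>" for x
  have g01: "0 \<le> g x" "g x \<le> 1" for x by (auto simp: g_def)
  have [measurable]: "g \<in> borel_measurable borel"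
    unfolding g_def by measurable
  have "integral\<^sup>L \<mu> g = 0"
  proof (rule LIMSEQ_unique)
    show "(\<lambda>n. integral\<^sup>L (bernstein_measure (r n)) g) \<longlonglongrightarrow> integral\<^sup>L \<mu> g"
      using g01 unfolding g_def by (intro lim continuous_intros contcl) auto
    have "integral\<^sup>L (bernstein_measure n) g = 0" for n
      by (subst integral_bernstein) (auto simp: clk g_def)
    then show "(\<lambda>n. integral\<^sup>L (bernstein_measure (r n)) g) \<longlonglongrightarrow> 0"
      by simp
  qed
  moreover have "integrable \<mu> g"
    using g01 by (intro \<mu>.integrable_const_bound[of _ 1]) (auto simp: g_def)
  ultimately have "AE x in \<mu>. g x = 0"
    using g01 by (subst (asm) integral_nonneg_eq_0_iff_AE) auto
  then have AE: "AE x in \<mu>. x = cl x"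
    by eventually_elim (auto simp: g_def min_def split: if_splits)
  have pow: "has_bochner_integral \<mu> (\<lambda>x. x ^ j) (L ([:0, 1:] ^ j))" for j
  proof -
    have "integrable \<mu> (\<lambda>x. cl x ^ j)"
      using cl01 by (intro \<mu>.integrable_const_bound[of _ 1]) (auto simp: power_le_one)
    then have "has_bochner_integral \<mu> (\<lambda>x. cl x ^ j) (L ([:0, 1:] ^ j))"
      by (simp add: has_bochner_integral_iff moment_cl)
    then show ?thesis
      using AE by (subst has_bochner_integral_cong_AE[of _ _ "\<lambda>x. cl x ^ j"]) auto
  qed
  have "has_bochner_integral \<mu> (poly p) (L p)" for p
    unfolding L_eq_sum_X_power[of p] poly_altdef
    by (intro has_bochner_integral_sum has_bochner_integral_mult_right pow)
  with \<mu> show thesis by (rule that)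
qed

end

section \<open>From Hankel positivity and growth to a representing measure\<close>

definition moment_functional :: "real fps \<Rightarrow> real poly \<Rightarrow> real" where
  "moment_functional f p = (\<Sum>i\<le>degree p. coeff p i * f $ i)"

lemma moment_functional_eq:
  assumes "degree p \<le> N"
  shows "moment_functional f p = (\<Sum>i\<le>N. coeff p i * f $ i)"
  unfolding moment_functional_def using assms
  by (intro sum.mono_neutral_left) (auto simp: coeff_eq_0)

interpretation moment_functional: linear_functional "moment_functional f" for f
proof
  fix p q :: "real poly" and c :: real
  let ?N = "max (degree p) (degree q)"
  show "moment_functional f (p + q) = moment_functional f p + moment_functional f q"
    by (simp add: moment_functional_eq[of _ ?N] degree_add_le distrib_right sum.distrib)
  show "moment_functional f (smult c p) = c * moment_functional f p"
    by (simp add: moment_functional_eq[of _ "degree p"] degree_smult_le sum_distrib_left mult.assoc)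
qed

lemma moment_functional_X_power: "moment_functional f ([:0, 1:] ^ n) = f $ n"
proof -
  have "[:0, 1:] ^ n = monom (1 :: real) n"
    by (simp add: monom_altdef)
  then have "moment_functional f ([:0, 1:] ^ n) = (\<Sum>i\<le>n. coeff (monom 1 n) i * f $ i)"
    by (simp add: moment_functional_def degree_monom_eq)
  also have "\<dots> = (\<Sum>i\<in>{n}. coeff (monom 1 n) i * f $ i)"
    by (rule sum.mono_neutral_right) auto
  finally show ?thesis by simp
qed

lemma pcompose_power: "(p ^ n) \<circ>\<^sub>p q = (p \<circ>\<^sub>p q) ^ n" for p :: "'a :: comm_semiring_1 poly"
  by (induction n) (simp_all add: pcompose_1 pcompose_mult)

text \<open>The value at \<open>p * p\<close> is the Hankel form of \<open>f\<close> at the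
  coefficients of \<open>p\<close>.\<close>

lemma moment_functional_square_nonneg:
  assumes "psd f"
  shows "0 \<le> moment_functional f (p * p)"
proof -
  let ?X = "[:0, 1:] :: real poly"
  have "p * p = (\<Sum>i\<le>degree p. smult (coeff p i) (?X ^ i)) * (\<Sum>i\<le>degree p. smult (coeff p i) (?X ^ i))"
    using poly_eq_sum_X_power[of p] by simp
  also have "\<dots> = (\<Sum>i\<le>degree p. \<Sum>j\<le>degree p. smult (coeff p i * coeff p j) (?X ^ (i + j)))"
    by (simp add: sum_product power_add mult_ac)
  finally have "moment_functional f (p * p) =
      (\<Sum>i\<le>degree p. \<Sum>j\<le>degree p. coeff p i * coeff p j * f $ (i + j))"
    by (simp add: moment_functional.L_sum moment_functional.L_smult moment_functional_X_power)
  then show ?thesis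
    using assms by (simp add: psd_def psd_upto_def)
qed

text \<open>The algebraic form of support in [-M, M]. The values of the functional at X^n p^2 again
  form a Hankel-positive sequence of growth rate \<open>M\<close>, so
  \<open>psd_bounded_ratio\<close> applies to its first two terms.\<close>

lemma moment_functional_X_square_bound:
  assumes "psd f" "0 < M" "\<And>n. \<bar>f $ n\<bar> \<le> C * M ^ n"
  shows "\<bar>moment_functional f ([:0, 1:] * (p * p))\<bar> \<le> M * moment_functional f (p * p)"
proof -
  let ?X = "[:0, 1:] :: real poly"
  define u where "u = Abs_fps (\<lambda>n. moment_functional f (?X ^ n * (p * p)))"
  have "psd u"
    unfolding psd_def psd_upto_def
  proof (intro allI)
    fix N and a :: "nat \<Rightarrow> real"
    let ?q = "\<Sum>i\<le>N. smult (a i) (?X ^ i * p)"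
    have "?q * ?q = (\<Sum>i\<le>N. \<Sum>j\<le>N. smult (a i * a j) (?X ^ (i + j) * (p * p)))"
      by (simp add: sum_product power_add mult_ac)
    then have "moment_functional f (?q * ?q) = (\<Sum>i\<le>N. \<Sum>j\<le>N. a i * a j * u $ (i + j))"
      by (simp add: moment_functional.L_sum moment_functional.L_smult u_def)
    then show "0 \<le> (\<Sum>i\<le>N. \<Sum>j\<le>N. a i * a j * u $ (i + j))"
      using moment_functional_square_nonneg[OF assms(1), of ?q] by simp
  qed
  \<comment> \<open>The constant depends on \<open>p\<close>, the rate \<open>M\<close> does
    not.\<close>
  moreover have "\<bar>u $ n\<bar> \<le> (\<Sum>i\<le>degree (p * p). \<bar>coeff (p * p) i\<bar> * (C * M ^ i)) * M ^ n" for n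
  proof -
    have "?X ^ n * (p * p) = (\<Sum>i\<le>degree (p * p). smult (coeff (p * p) i) (?X ^ (n + i)))"
      by (subst (1) poly_eq_sum_X_power[of "p * p"]) (simp add: sum_distrib_left power_add)
    then have "u $ n = (\<Sum>i\<le>degree (p * p). coeff (p * p) i * f $ (n + i))"
      by (simp add: u_def moment_functional.L_sum moment_functional.L_smult moment_functional_X_power)
    also have "\<bar>\<dots>\<bar> \<le> (\<Sum>i\<le>degree (p * p). \<bar>coeff (p * p) i\<bar> * (C * M ^ (n + i)))"
      by (rule order.trans[OF sum_abs])
        (auto simp: abs_mult intro!: sum_mono mult_left_mono assms)
    also have "\<dots> = (\<Sum>i\<le>degree (p * p). \<bar>coeff (p * p) i\<bar> * (C * M ^ i)) * M ^ n"
      by (simp add: sum_distrib_left power_add mult_ac)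
    finally show ?thesis .
  qed
  ultimately have "\<bar>u $ 1\<bar> \<le> M * u $ 0"
    by (rule psd_bounded_ratio[OF _ assms(2)])
  then show ?thesis by (simp add: u_def)
qed

text \<open>The affine polynomial \<open>a\<close> maps [-M, M] onto [0,1]. The transported
  functional satisfies Hausdorff's condition, and its measure is pushed back by the inverse map
  \<open>h\<close>.\<close>

theorem positive_definite_seqI:
  assumes "psd f" "f $ 0 = 1" and M: "0 < M" "\<And>n. \<bar>f $ n\<bar> \<le> C * M ^ n"
  shows "positive_definite_seq (fps_nth f)"
proof -
  define a where "a = [:1 / 2, 1 / (2 * M):]"
  define b where "b = [:1 / 2, - 1 / (2 * M):]"
  let ?L = "moment_functional f"
  have ab: "a + b = 1"
    by (simp add: a_def b_def one_pCons)
  have split_a: "a * r = smult (1 / 2) r + smult (1 / (2 * M)) ([:0, 1:] * r)"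
   and split_b: "b * r = smult (1 / 2) r + smult (- 1 / (2 * M)) ([:0, 1:] * r)" for r
    by (simp_all add: a_def b_def)
  have bd: "\<bar>?L ([:0, 1:] * (q * q))\<bar> \<le> M * ?L (q * q)" for q
    by (rule moment_functional_X_square_bound[OF assms(1) M])
  have La: "0 \<le> ?L (a * (q * q))" and Lb: "0 \<le> ?L (b * (q * q))" for q
    using bd[of q] M unfolding split_a split_b moment_functional.L_add moment_functional.L_smult
    by (auto simp: field_simps)
  have nonneg: "0 \<le> ?L (a ^ k * b ^ l)" for k l
  proof -
    let ?q = "a ^ (k div 2) * b ^ (l div 2)"
    have k: "a ^ k = a ^ (k mod 2) * (a ^ (k div 2) * a ^ (k div 2))" for a :: "real poly" and k
      by (metis mod_mult_div_eq mult.commute power_add power2_eq_square power_mult)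
    \<comment> \<open>Splitting off the square \<open>?q * ?q\<close> leaves exponents 0 or
      1.\<close>
    have *: "a ^ k * b ^ l = a ^ (k mod 2) * b ^ (l mod 2) * (?q * ?q)"
      by (subst k, subst (2) k) (simp add: mult_ac)
    consider "k mod 2 = 0" "l mod 2 = 0" | "k mod 2 = 1" "l mod 2 = 0"
      | "k mod 2 = 0" "l mod 2 = 1" | "k mod 2 = 1" "l mod 2 = 1"
      by (metis mod2_eq_if)
    then show ?thesis
    proof cases
      case 1
      then show ?thesis using moment_functional_square_nonneg[OF assms(1), of ?q] by (simp add: *)
    next
      case 2
      then show ?thesis using La[of ?q] by (simp add: *)
    next
      case 3
      then show ?thesis using Lb[of ?q] by (simp add: *)
    next
      case 4
      \<comment> \<open>Since \<open>a + b = 1\<close>, the product \<open>a * b\<close> equals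
        \<open>a * b^2 + b * a^2\<close>, which reduces the mixed case to single factors times
        squares.\<close>
      have "a * b * (?q * ?q) = (a + b) * (a * b * (?q * ?q))"
        by (simp add: ab)
      also have "\<dots> = a * ((b * ?q) * (b * ?q))  + b * ((a * ?q) * (a * ?q))"
        by (simp only: ring_distribs mult_ac add_ac)
      also have "0 \<le> ?L \<dots>"
        unfolding moment_functional.L_add by (intro add_nonneg_nonneg La Lb)
      finally show ?thesis using 4 by (simp add: *)
    qed
  qed
  define L where "L q = ?L (q \<circ>\<^sub>p a)" for q
  interpret hausdorff L
  proof
    show "L (p + q) = L p + L q" for p q
      by (simp add: L_def pcompose_add moment_functional.L_add)
    show "L (smult c p) = c * L p" for c p
      by (simp add: L_def pcompose_smult moment_functional.L_smult)
    show "L 1 = 1"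
      using moment_functional_X_power[of f 0] by (simp add: L_def pcompose_1 assms)
    have "[:0, 1:] \<circ>\<^sub>p a = a" "[:1, -1:] \<circ>\<^sub>p a = b"
      by (simp_all add: pcompose_pCons a_def b_def)
    then show "0 \<le> L ([:0, 1:] ^ k * [:1, -1:] ^ l)" for k l
      using nonneg[of k l]
      by (simp add: L_def pcompose_mult pcompose_power)
  qed
  obtain \<mu> where \<mu>: "real_distribution \<mu>" and int: "\<And>p. has_bochner_integral \<mu> (poly p) (L p)"
    by (rule hausdorff_moment_problem) blast
  interpret \<mu>: real_distribution \<mu> by (rule \<mu>)
  define h where "h = [:- M, 2 * M:]"
  have "h \<circ>\<^sub>p a = [:0, 1:]"
    using M by (simp add: h_def a_def pcompose_pCons)
  then have L: "L (h ^ n) = f $ n" for n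
    by (simp add: L_def pcompose_power moment_functional_X_power)
  let ?\<nu> = "distr \<mu> borel (poly h)"
  have meas: "poly h \<in> borel_measurable \<mu>"
    by (simp add: borel_measurable_continuous_onI continuous_intros)
  have "real_distribution ?\<nu>"
    by (rule \<mu>.real_distribution_distr) (fact meas)
  moreover have "has_bochner_integral ?\<nu> (\<lambda>x. x ^ n) (f $ n)" for n
  proof (rule has_bochner_integral_distr)
    have "has_bochner_integral \<mu> (poly (h ^ n)) (L (h ^ n))" by (rule int)
    then show "has_bochner_integral \<mu> (\<lambda>x. poly h x ^ n) (f $ n)"
      by (simp add: L poly_power[abs_def])
  qed (use meas in simp_all)
  ultimately show ?thesis
    unfolding positive_definite_seq_def by blast
qed

text \<open>The Hankel form is the integral of the square of a polynomial.\<close>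

lemma positive_definite_seqD:
  assumes "positive_definite_seq s"
  shows "psd (Abs_fps s)"
proof -
  obtain \<mu> :: "real measure" where \<mu>: "real_distribution \<mu>"
    and s: "\<And>n. has_bochner_integral \<mu> (\<lambda>x. x ^ n) (s n)"
    using assms unfolding positive_definite_seq_def by blast
  show ?thesis
    unfolding psd_def psd_upto_def
  proof (intro allI)
    fix N and a :: "nat \<Rightarrow> real"
    have "has_bochner_integral \<mu> (\<lambda>x. \<Sum>i\<le>N. \<Sum>j\<le>N. a i * a j * x ^ (i + j))
        (\<Sum>i\<le>N. \<Sum>j\<le>N. a i * a j * s (i + j))"
      by (intro has_bochner_integral_sum has_bochner_integral_mult_right s)
    moreover have "(\<Sum>i\<le>N. \<Sum>j\<le>N. a i * a j * x ^ (i + j)) = (\<Sum>i\<le>N. a i * x ^ i)\<^sup>2" for x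
      by (simp add: power2_eq_square sum_product power_add mult_ac)
    ultimately have "has_bochner_integral \<mu> (\<lambda>x. (\<Sum>i\<le>N. a i * x ^ i)\<^sup>2)
        (\<Sum>i\<le>N. \<Sum>j\<le>N. a i * a j * s (i + j))"
      by simp
    then have "(\<Sum>i\<le>N. \<Sum>j\<le>N. a i * a j * s (i + j)) = (LINT x|\<mu>. (\<Sum>i\<le>N. a i * x ^ i)\<^sup>2)"
      by (simp add: has_bochner_integral_iff)
    also have "\<dots> \<ge> 0"
      by (intro Bochner_Integration.integral_nonneg) simp
    finally have "0 \<le> (\<Sum>i\<le>N. \<Sum>j\<le>N. a i * a j * s (i + j))" .
    then show "0 \<le> (\<Sum>i\<le>N. \<Sum>j\<le>N. a i * a j * Abs_fps s $ (i + j))"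
      by simp
  qed
qed

section \<open>Taylor series of rational functions\<close>

text \<open>While \<open>rf_taylor\<close> is defined through the reduced fraction, any denominator
  nonvanishing at 0 serves, because the reduced denominator divides it.\<close>

lemma rf_taylor_fraction:
  assumes "poly q 0 \<noteq> 0"
  shows "rf_taylor (to_fract p / to_fract q) = fps_of_poly p / fps_of_poly q"
    and "poly (snd (quot_of_fract (to_fract p / to_fract q))) 0 \<noteq> 0"
proof -
  let ?F = "to_fract p / to_fract q"
  define n d where "n = fst (quot_of_fract ?F)" and "d = snd (quot_of_fract ?F)"
  have q: "q \<noteq> 0" and d: "d \<noteq> 0"
    using assms by (auto simp: d_def)
  have "to_fract n / to_fract d = ?F"
    using Fract_quot_of_fract[of ?F] by (simp add: n_def d_def Fract_conv_to_fract)
  then have "to_fract (n * q) = to_fract (p * d)"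
    using q d by (simp add: to_fract_mult field_simps)
  then have eq: "n * q = p * d"
    by (simp only: to_fract_eq_iff)
  have "coprime d n"
    using coprime_quot_of_fract[of ?F] by (simp add: n_def d_def coprime_commute)
  moreover have "d dvd n * q"
    by (simp add: eq)
  ultimately have "d dvd q"
    by (simp add: coprime_dvd_mult_right_iff)
  with assms have d0: "poly d 0 \<noteq> 0"
    by auto
  have "fps_of_poly n / fps_of_poly d = fps_of_poly p / fps_of_poly q"
  proof -
    have unit: "fps_of_poly d $ 0 \<noteq> 0" "fps_of_poly q $ 0 \<noteq> 0"
      using d0 assms by (simp_all add: poly_0_coeff_0)
    have "fps_of_poly n * fps_of_poly q = fps_of_poly p * fps_of_poly d"
      by (simp add: eq flip: fps_of_poly_mult)
    then have "fps_of_poly n * fps_of_poly q * (inverse (fps_of_poly q) * inverse (fps_of_poly d)) =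
        fps_of_poly p * fps_of_poly d * (inverse (fps_of_poly q) * inverse (fps_of_poly d))"
      by (rule arg_cong)
    then have "fps_of_poly n * inverse (fps_of_poly d) * (fps_of_poly q * inverse (fps_of_poly q)) =
        fps_of_poly p * inverse (fps_of_poly q) * (fps_of_poly d * inverse (fps_of_poly d))"
      by (simp only: mult_ac)
    then show ?thesis
      by (simp only: inverse_mult_eq_1' unit fps_divide_unit mult_1_right simp_thms)
  qed
  then show "rf_taylor ?F = fps_of_poly p / fps_of_poly q"
    by (simp add: rf_taylor_def n_def d_def)
  show "poly (snd (quot_of_fract ?F)) 0 \<noteq> 0"
    using d0 by (simp add: d_def)
qed

text \<open>The local ring at 0, on which \<open>rf_taylor\<close> is an injective ring
  homomorphism.\<close>

definition regular_at_0 :: "ratfun set" where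
  "regular_at_0 = {F. poly (snd (quot_of_fract F)) 0 \<noteq> 0}"

lemma regular_at_0_fraction [intro]:
  "poly q 0 \<noteq> 0 \<Longrightarrow> to_fract p / to_fract q \<in> regular_at_0"
  by (simp add: regular_at_0_def rf_taylor_fraction)

lemma regular_at_0_cases:
  assumes "F \<in> regular_at_0"
  obtains p q where "F = to_fract p / to_fract q" "coprime p q" "poly q 0 \<noteq> 0" "q \<noteq> 0"
    "rf_taylor F = fps_of_poly p / fps_of_poly q"
proof
  show "F = to_fract (fst (quot_of_fract F)) / to_fract (snd (quot_of_fract F))"
    using Fract_quot_of_fract[of F] by (simp add: Fract_conv_to_fract)
qed (use assms in \<open>simp_all add: regular_at_0_def coprime_quot_of_fract rf_taylor_def\<close>)

lemma regular_at_0_to_fract: "to_fract p \<in> regular_at_0"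
  and rf_taylor_to_fract: "rf_taylor (to_fract p) = fps_of_poly p"
  using regular_at_0_fraction[of 1 p] rf_taylor_fraction[of 1 p] by simp_all

lemma regular_at_0_const: "rf_const c \<in> regular_at_0"
  and rf_taylor_const: "rf_taylor (rf_const c) = fps_const c"
  by (simp_all add: rf_const_def regular_at_0_to_fract rf_taylor_to_fract fps_of_poly_const)

lemma regular_at_0_X: "rf_X \<in> regular_at_0"
  and rf_taylor_X: "rf_taylor rf_X = fps_X"
  by (simp_all add: rf_X_def regular_at_0_to_fract rf_taylor_to_fract)

lemma regular_at_0_1: "1 \<in> regular_at_0"
  and rf_taylor_1: "rf_taylor 1 = 1"
  using regular_at_0_to_fract[of 1] rf_taylor_to_fract[of 1] by simp_all

lemma
  assumes "F \<in> regular_at_0" "G \<in> regular_at_0"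
  shows regular_at_0_add: "F + G \<in> regular_at_0"
    and rf_taylor_add: "rf_taylor (F + G) = rf_taylor F + rf_taylor G"
    and regular_at_0_mult: "F * G \<in> regular_at_0"
    and rf_taylor_mult: "rf_taylor (F * G) = rf_taylor F * rf_taylor G"
proof -
  obtain p q where F: "F = to_fract p / to_fract q" "poly q 0 \<noteq> 0" "q \<noteq> 0"
    "rf_taylor F = fps_of_poly p / fps_of_poly q"
    using assms(1) by (rule regular_at_0_cases)
  obtain p' q' where G: "G = to_fract p' / to_fract q'" "poly q' 0 \<noteq> 0" "q' \<noteq> 0"
    "rf_taylor G = fps_of_poly p' / fps_of_poly q'"
    using assms(2) by (rule regular_at_0_cases)
  have qq: "poly (q * q') 0 \<noteq> 0" using F G by simp
  have add: "F + G = to_fract (p * q' + p' * q) / to_fract (q * q')"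
    and mult: "F * G = to_fract (p * p') / to_fract (q * q')"
    using F(3) G(3) by (simp_all add: F(1) G(1) to_fract_mult to_fract_add field_simps)
  show "F + G \<in> regular_at_0" "F * G \<in> regular_at_0"
    unfolding add mult by (rule regular_at_0_fraction[OF qq])+
  let ?p = "fps_of_poly p" and ?q = "fps_of_poly q" and ?p' = "fps_of_poly p'" and ?q' = "fps_of_poly q'"
  have q0: "?q $ 0 \<noteq> 0" "?q' $ 0 \<noteq> 0"
    using F(2) G(2) by (simp_all add: poly_0_coeff_0)
  show "rf_taylor (F * G) = rf_taylor F * rf_taylor G"
    unfolding mult rf_taylor_fraction(1)[OF qq] F(4) G(4) using q0
    by (simp add: fps_of_poly_mult fps_divide_unit fps_inverse_mult)
  have "rf_taylor (F + G) = (?p * ?q' + ?p' * ?q) * (inverse ?q * inverse ?q')"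
    unfolding add rf_taylor_fraction(1)[OF qq] using q0
    by (simp add: fps_of_poly_mult fps_of_poly_add fps_divide_unit fps_inverse_mult)
  also have "\<dots> = ?p * inverse ?q * (?q' * inverse ?q') + ?p' * inverse ?q' * (?q * inverse ?q)"
    by (simp only: ring_distribs mult_ac)
  also have "\<dots> = rf_taylor F + rf_taylor G"
    unfolding F(4) G(4) using q0 by (simp add: fps_divide_unit inverse_mult_eq_1')
  finally show "rf_taylor (F + G) = rf_taylor F + rf_taylor G" .
qed

lemma regular_at_0_diff: "F \<in> regular_at_0 \<Longrightarrow> G \<in> regular_at_0 \<Longrightarrow> F - G \<in> regular_at_0"
  and rf_taylor_diff: "F \<in> regular_at_0 \<Longrightarrow> G \<in> regular_at_0 \<Longrightarrow> rf_taylor (F - G) = rf_taylor F - rf_taylor G"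
proof -
  assume *: "F \<in> regular_at_0" "G \<in> regular_at_0"
  have "rf_const (-1) = -1"
    unfolding rf_const_def by (metis minus_pCons minus_zero one_pCons to_fract_1 to_fract_uminus)
  then have eq: "F - G = F + rf_const (-1) * G"
    by simp
  show "F - G \<in> regular_at_0"
    unfolding eq using * by (intro regular_at_0_add regular_at_0_mult regular_at_0_const)
  show "rf_taylor (F - G) = rf_taylor F - rf_taylor G"
    unfolding eq using *
    by (simp add: rf_taylor_add rf_taylor_mult regular_at_0_mult regular_at_0_const rf_taylor_const
        flip: fps_const_neg)
qed

text \<open>Lets identities between rational functions, such as the laws of composition, be checked
  on power series. A difference with zero series has zero numerator.\<close>

lemma rf_taylor_inject:
  assumes "F \<in> regular_at_0" "G \<in> regular_at_0" "rf_taylor F = rf_taylor G"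
  shows "F = G"
proof -
  obtain p q where pq: "F - G = to_fract p / to_fract q" "poly q 0 \<noteq> 0"
    "rf_taylor (F - G) = fps_of_poly p / fps_of_poly q"
    using regular_at_0_diff[OF assms(1,2)] by (rule regular_at_0_cases)
  have "fps_of_poly p / fps_of_poly q = 0"
    using pq(3) assms by (simp add: rf_taylor_diff)
  moreover have "fps_of_poly q $ 0 \<noteq> 0"
    using pq(2) by (simp add: poly_0_coeff_0)
  ultimately have "fps_of_poly p = 0"
    by (simp add: fps_divide_unit fps_inverse_eq_0_iff del: fps_of_poly_nth)
  then have "p = 0"
    by (metis fps_of_poly_0 fps_of_poly_eq_iff)
  with pq(1) show ?thesis by simp
qed

lemma
  assumes "F \<in> regular_at_0" "rf_taylor F $ 0 \<noteq> 0"
  shows regular_at_0_inverse: "inverse F \<in> regular_at_0"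
    and rf_taylor_inverse: "rf_taylor (inverse F) = inverse (rf_taylor F)"
    and rf_taylor_nonzero: "F \<noteq> 0"
proof -
  obtain p q where F: "F = to_fract p / to_fract q" "poly q 0 \<noteq> 0" "q \<noteq> 0"
    "rf_taylor F = fps_of_poly p / fps_of_poly q"
    using assms(1) by (rule regular_at_0_cases)
  have p: "poly p 0 \<noteq> 0"
    using assms(2) F(2) unfolding F(4) by (auto simp: fps_divide_unit poly_0_coeff_0)
  have inv: "inverse F = to_fract q / to_fract p"
    by (simp add: F(1))
  show reg: "inverse F \<in> regular_at_0"
    unfolding inv using p by auto
  show nz: "F \<noteq> 0"
    using p F(3) by (auto simp: F(1))
  have "rf_taylor F * rf_taylor (inverse F) = 1"
    using nz by (simp add: rf_taylor_1 flip: rf_taylor_mult[OF assms(1) reg])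
  then show "rf_taylor (inverse F) = inverse (rf_taylor F)"
    by (simp add: fps_inverse_unique)
qed

text \<open>Dividing both parts of the reduced fraction of \<open>U\<close> by their common value at
  0 gives the normalisation in \<open>F_class\<close>.\<close>

lemma F_class_iff:
  "F \<in> F_class \<longleftrightarrow> (\<exists>U \<in> regular_at_0. rf_taylor U $ 0 = 1 \<and> F = rf_X * U)"
proof
  assume "F \<in> F_class"
  then obtain P Q where *: "F = rf_X * to_fract P / to_fract Q" "poly P 0 = 1" "poly Q 0 = 1"
    unfolding F_class_def by blast
  then have "rf_taylor (to_fract P / to_fract Q) $ 0 = 1"
    by (simp add: rf_taylor_fraction fps_divide_unit poly_0_coeff_0)
  with * show "\<exists>U \<in> regular_at_0. rf_taylor U $ 0 = 1 \<and> F = rf_X * U"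
    by (intro bexI[of _ "to_fract P / to_fract Q"]) auto
next
  assume "\<exists>U \<in> regular_at_0. rf_taylor U $ 0 = 1 \<and> F = rf_X * U"
  then obtain U where U: "U \<in> regular_at_0" "rf_taylor U $ 0 = 1" "F = rf_X * U" by blast
  obtain p q where pq: "U = to_fract p / to_fract q" "coprime p q" "poly q 0 \<noteq> 0"
    "rf_taylor U = fps_of_poly p / fps_of_poly q"
    using U(1) by (rule regular_at_0_cases)
  define c where "c = poly q 0"
  have p: "poly p 0 = c"
    using U(2) pq(3) unfolding pq(4) c_def by (simp add: fps_divide_unit poly_0_coeff_0 field_simps)
  have c: "c \<noteq> 0" using pq(3) by (simp add: c_def)
  define P Q where "P = smult (inverse c) p" and "Q = smult (inverse c) q"
  have "coprime P Q"
  proof -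
    have "is_unit [:inverse c:]"
      using c by (intro is_unit_triv) simp
    moreover have "P = [:inverse c:] * p" "Q = [:inverse c:] * q"
      by (simp_all add: P_def Q_def)
    ultimately show ?thesis
      using pq(2) by (simp only: coprime_mult_left_iff coprime_mult_right_iff
          is_unit_left_imp_coprime is_unit_right_imp_coprime simp_thms)
  qed
  moreover have "poly P 0 = 1" "poly Q 0 = 1"
    using c p by (simp_all add: P_def Q_def c_def)
  moreover have "F = rf_X * to_fract P / to_fract Q"
  proof -
    have "to_fract P = rf_const (inverse c) * to_fract p" "to_fract Q = rf_const (inverse c) * to_fract q"
      by (simp_all add: P_def Q_def rf_const_def flip: to_fract_mult)
    moreover have "rf_const (inverse c) \<noteq> 0"
      using c by (simp add: rf_const_def)
    ultimately show ?thesis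
      by (simp add: U(3) pq(1))
  qed
  ultimately show "F \<in> F_class"
    unfolding F_class_def by blast
qed

lemma F_classE:
  assumes "F \<in> F_class"
  obtains U where "U \<in> regular_at_0" "rf_taylor U $ 0 = 1" "F = rf_X * U" "U \<noteq> 0"
    "F \<in> regular_at_0" "rf_taylor F = fps_X * rf_taylor U" "rf_taylor F $ 0 = 0" "rf_taylor F $ 1 = 1"
  using assms rf_taylor_nonzero
  by (auto simp: F_class_iff regular_at_0_mult regular_at_0_X rf_taylor_mult rf_taylor_X)

lemma
  assumes "G \<in> regular_at_0" "rf_taylor G $ 0 = 0"
  shows regular_at_0_eval_poly: "rf_eval_poly p G \<in> regular_at_0"
    and rf_taylor_eval_poly: "rf_taylor (rf_eval_poly p G) = fps_of_poly p oo rf_taylor G"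
proof -
  have "rf_eval_poly p G \<in> regular_at_0 \<and> rf_taylor (rf_eval_poly p G) = fps_of_poly p oo rf_taylor G"
  proof (induction p)
    case 0
    then show ?case
      using regular_at_0_to_fract[of 0] rf_taylor_to_fract[of 0] by (simp add: rf_eval_poly_def)
  next
    case (pCons c p)
    have "rf_const 0 = 0" by (simp add: rf_const_def)
    then have "rf_eval_poly (pCons c p) G = rf_const c + G * rf_eval_poly p G"
      using pCons.hyps by (simp add: rf_eval_poly_def map_poly_pCons)
    moreover have "fps_of_poly (pCons c p) oo rf_taylor G =
        fps_const c + rf_taylor G * (fps_of_poly p oo rf_taylor G)"
      using assms(2) by (simp add: fps_of_poly_pCons fps_compose_add_distrib
          fps_compose_mult_distrib mult.commute)
    ultimately show ?case
      using pCons.IH assms(1) by (simp add: regular_at_0_add regular_at_0_mult regular_at_0_const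
          rf_taylor_add rf_taylor_mult rf_taylor_const)
  qed
  then show "rf_eval_poly p G \<in> regular_at_0"
    "rf_taylor (rf_eval_poly p G) = fps_of_poly p oo rf_taylor G"
    by simp_all
qed

lemma
  assumes "F \<in> regular_at_0" "G \<in> regular_at_0" "rf_taylor G $ 0 = 0"
  shows regular_at_0_compose: "rf_compose F G \<in> regular_at_0"
    and rf_taylor_compose: "rf_taylor (rf_compose F G) = rf_taylor F oo rf_taylor G"
proof -
  let ?n = "fst (quot_of_fract F)" and ?d = "snd (quot_of_fract F)" and ?g = "rf_taylor G"
  have d: "fps_of_poly ?d $ 0 \<noteq> 0"
    using assms(1) by (simp add: regular_at_0_def poly_0_coeff_0)
  have eq: "rf_compose F G = rf_eval_poly ?n G * inverse (rf_eval_poly ?d G)"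
    by (simp add: rf_compose_def divide_inverse)
  note reg = regular_at_0_eval_poly[OF assms(2,3)] and taylor = rf_taylor_eval_poly[OF assms(2,3)]
  \<comment> \<open>Since \<open>G\<close> vanishes at 0, the denominator evaluated at
    \<open>G\<close> keeps its constant term, so the quotient in \<open>rf_compose\<close> is a
    genuine one.\<close>
  have d0: "rf_taylor (rf_eval_poly ?d G) $ 0 \<noteq> 0"
    using d by (simp add: taylor)
  note inv = regular_at_0_inverse[OF reg d0]
  show "rf_compose F G \<in> regular_at_0"
    unfolding eq by (intro regular_at_0_mult reg inv)
  have "(inverse (fps_of_poly ?d) oo ?g) = inverse (fps_of_poly ?d oo ?g)"
  proof (rule fps_inverse_unique[symmetric])
    have "(fps_of_poly ?d oo ?g) * (inverse (fps_of_poly ?d) oo ?g) =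
        (fps_of_poly ?d * inverse (fps_of_poly ?d)) oo ?g"
      by (rule fps_compose_mult_distrib[symmetric]) fact
    then show "(fps_of_poly ?d oo ?g) * (inverse (fps_of_poly ?d) oo ?g) = 1"
      by (simp only: inverse_mult_eq_1'[OF d] fps_compose_1)
  qed
  then show "rf_taylor (rf_compose F G) = rf_taylor F oo ?g"
    using d assms(3)
    by (simp add: eq rf_taylor_mult reg inv rf_taylor_inverse d0 taylor rf_taylor_def[of F]
        fps_divide_unit fps_compose_mult_distrib)
qed

section \<open>Free convolution\<close>

lemma fps_inv_unique:
  fixes f D :: "real fps"
  assumes "f $ 0 = 0" "f $ 1 \<noteq> 0" "D $ 0 = 0" "f oo D = fps_X"
  shows "fps_inv f = D"
proof -
  have "fps_inv f oo (f oo D) = (fps_inv f oo f) oo D"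
    by (rule fps_compose_assoc) (use assms in auto)
  then show ?thesis
    using assms by (simp add: fps_inv)
qed

text \<open>The series S in D = z * S; for the Taylor series of a rational function its coefficients
  are the \<open>moment_seq\<close>.\<close>

definition moment_fps :: "real fps \<Rightarrow> real fps" where
  "moment_fps f = fps_shift 1 (fps_inv f)"

lemma
  fixes f :: "real fps"
  assumes "f $ 0 = 0" "f $ 1 = 1"
  shows fps_inv_eq_moment_fps: "fps_inv f = fps_X * moment_fps f"
    and moment_fps_0: "moment_fps f $ 0 = 1"
    and compose_moment_fps: "f oo (fps_X * moment_fps f) = fps_X"
proof -
  have "fps_inv f $ 0 = 0" by (simp add: fps_inv_def)
  then show eq: "fps_inv f = fps_X * moment_fps f"
    by (intro fps_ext) (simp add: moment_fps_def)
  show "moment_fps f $ 0 = 1"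
    using assms by (simp add: moment_fps_def fps_inv_def)
  show "f oo (fps_X * moment_fps f) = fps_X"
    using fps_inv_right[of f] assms by (simp add: eq)
qed

lemma moment_fps_unique:
  assumes "f $ 0 = 0" "f $ 1 = 1" "f oo (fps_X * S) = fps_X"
  shows "moment_fps f = S"
proof -
  have "fps_inv f = fps_X * S"
    using assms by (intro fps_inv_unique) auto
  then show ?thesis
    by (intro fps_ext) (simp add: moment_fps_def)
qed

text \<open>Here \<open>S\<close> is the moment series of a larger free convolution and
  \<open>fps_X * g\<close> the subordination function of the summand \<open>fps_X * u\<close>.\<close>

lemma subordination:
  fixes u S B :: "real fps" and b :: real
  assumes u: "u $ 0 = 1" and S: "S $ 0 = 1" and energy: "self_energy (moment_fps (fps_X * u)) B b"
  defines "v \<equiv> u oo (fps_X * S)"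
  defines "g \<equiv> S * v"
  shows "g $ 0 = 1"
    and "g * (moment_fps (fps_X * u) oo (fps_X * g)) = S"
    and "fps_X * g * ((fps_const b + fps_X * B) oo (fps_X * g)) = 1 - v"
proof -
  let ?S1 = "moment_fps (fps_X * u)" and ?e = "fps_const b + fps_X * B"
  interpret self_energy ?S1 B b by (rule energy)
  show "g $ 0 = 1"
    by (simp add: g_def v_def u S)
  have g: "(fps_X * u) oo (fps_X * S) = fps_X * g"
    by (simp add: fps_compose_mult_distrib g_def v_def mult.assoc)
  have inv: "fps_inv (fps_X * u) = fps_X * ?S1"
    using u by (intro fps_inv_eq_moment_fps) auto
  \<comment> \<open>The subordination function is \<open>fps_X * u\<close> composed with
    \<open>fps_X * S\<close>, so the inverse of \<open>fps_X * u\<close> recovers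
    \<open>fps_X * S\<close> from it.\<close>
  have "(fps_X * ?S1) oo (fps_X * g) = ((fps_X * ?S1) oo (fps_X * u)) oo (fps_X * S)"
    unfolding g[symmetric] by (rule fps_compose_assoc) auto
  also have "\<dots> = fps_X * S"
    unfolding inv[symmetric] using u by (subst fps_inv) auto
  finally have "fps_X * (g * (?S1 oo (fps_X * g))) = fps_X * S"
    by (simp add: fps_compose_mult_distrib mult.assoc)
  then show S1: "g * (?S1 oo (fps_X * g)) = S"
    by simp
  \<comment> \<open>The J-fraction of \<open>?S1\<close> at the subordination function; multiplied
    by \<open>g\<close> it leaves \<open>S * v\<close> on the right, and \<open>S\<close>
    cancels.\<close>
  have "(?S1 oo (fps_X * g)) * (1 - fps_X * g * (?e oo (fps_X * g))) = 1"
    using arg_cong[OF S_eq, of "\<lambda>f. f oo (fps_X * g)"]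
    by (simp add: fps_compose_mult_distrib fps_compose_sub_distrib)
  then have "g * (?S1 oo (fps_X * g)) * (1 - fps_X * g * (?e oo (fps_X * g))) = g"
    by (simp only: mult.assoc mult_1_right)
  then have "S * (1 - fps_X * g * (?e oo (fps_X * g))) = S * v"
    unfolding S1 by (simp only: g_def)
  moreover have "S \<noteq> 0" using S by auto
  ultimately have "1 - fps_X * g * (?e oo (fps_X * g)) = v"
    by (simp only: mult_cancel_left simp_thms)
  then show "fps_X * g * (?e oo (fps_X * g)) = 1 - v"
    by (metis add_diff_cancel_left' diff_add_cancel)
qed

text \<open>This is F(D) = z for F(w) = w * u(w) and D = z * S, with a factor z cancelled.\<close>

lemma moment_fps_reciprocal:
  fixes u :: "real fps"
  assumes "u $ 0 = 1"
  shows "moment_fps (fps_X * u) * (u oo (fps_X * moment_fps (fps_X * u))) = 1"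
proof -
  let ?S = "moment_fps (fps_X * u)"
  have "fps_X * (?S * (u oo (fps_X * ?S))) = fps_X * 1"
    using compose_moment_fps[of "fps_X * u"] assms by (simp add: fps_compose_mult_distrib mult.assoc)
  then show ?thesis by (simp only: mult_cancel_left fps_X_neq_zero simp_thms)
qed

text \<open>The hypothesis relating \<open>u\<close> to \<open>u1\<close> and \<open>u2\<close> reads \<open>1 / u = 1 / u1 + 1 / u2 - 1\<close>.\<close>

lemma psd_free_add:
  fixes u u1 u2 :: "real fps"
  assumes u: "u $ 0 = 1" "u1 $ 0 = 1" "u2 $ 0 = 1"
    and eq: "u1 * u2 = u * (u1 + u2 - u1 * u2)"
    and psd: "psd (moment_fps (fps_X * u1))" "psd (moment_fps (fps_X * u2))"
  shows "psd (moment_fps (fps_X * u))"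
proof -
  define S where "S = moment_fps (fps_X * u)"
  let ?D = "fps_X * S"
  define v v1 v2 where "v = u oo ?D" and "v1 = u1 oo ?D" and "v2 = u2 oo ?D"
  define g1 g2 where "g1 = S * v1" and "g2 = S * v2"
  note defs = v1_def v2_def g1_def g2_def
  have S0: "S $ 0 = 1"
    unfolding S_def using u by (intro moment_fps_0) auto
  have Sv: "S * v = 1"
    unfolding S_def v_def using u(1) by (rule moment_fps_reciprocal)
  have D0: "?D $ 0 = 0" by simp
  have "v1 * v2 = v * (v1 + v2 - v1 * v2)"
    using arg_cong[OF eq, of "\<lambda>f. f oo ?D"] unfolding v_def v1_def v2_def
    by (simp only: fps_compose_mult_distrib[OF D0] fps_compose_add_distrib fps_compose_sub_distrib)
  from arg_cong[OF this, of "\<lambda>x. S * x"]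
  have "S * (v1 * v2) = S * v * (v1 + v2 - v1 * v2)"
    by (simp only: mult.assoc)
  then have Sv12: "S * v1 * v2 = v1 + v2 - v1 * v2"
    unfolding Sv by (simp only: mult.assoc mult_1_left)
  obtain b1 B1 where e1: "self_energy (moment_fps (fps_X * u1)) B1 b1"
    by (rule self_energy_exists[OF moment_fps_0[of "fps_X * u1"]]) (use u in auto)
  obtain b2 B2 where e2: "self_energy (moment_fps (fps_X * u2)) B2 b2"
    by (rule self_energy_exists[OF moment_fps_0[of "fps_X * u2"]]) (use u in auto)
  note sub1 = subordination[OF u(2) S0 e1, folded defs]
  note sub2 = subordination[OF u(3) S0 e2, folded defs]
  \<comment> \<open>Both fixed-point equations are instances, with the summands exchanged. After
    multiplication by \<open>g'\<close> the last premise collapses the left side to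
    \<open>S * w'\<close>.\<close>
  have cross: "(g * (1 - x)) = 1" if "x * g' = 1 - w'" "g = S * w" "g' = S * w'" "g' $ 0 = 1"
     "S * w' * w = w' + w - w' * w" for g g' w w' x :: "real fps"
  proof -
    have prod: "g * g' = S * (S * w' * w)"
      by (simp only: that(2,3) mult_ac)
    have "g' * (g * (1 - x)) = g * g' - g * (x * g')"
      by (simp only: right_diff_distrib mult_1_left mult_1_right mult_ac)
    also have "\<dots> = S * (S * w' * w) - S * w * (1 - w')"
      by (subst prod, subst that(1), subst that(2), rule refl)
    also have "\<dots> = S * w'"
      unfolding that(5) by (simp add: algebra_simps)
    also have "\<dots> = g' * 1"
      by (simp only: that(3) mult_1_right)
    finally show ?thesis
      using that(4) by (subst (asm) mult_cancel_left) auto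
  qed
  have "psd g1"
  proof (rule psd_subordination_add)
    show "psd B1" "psd B2"
      using self_energy.psd_B[OF e1] self_energy.psd_B[OF e2] psd by auto
    show "g1 $ 0 = 1" "g2 $ 0 = 1" by (rule sub1 sub2)+
    show "g2 * (1 - fps_X * (fps_const b1 + fps_X * B1 oo fps_X * g1)) = 1"
    proof (rule cross[OF _ g2_def g1_def sub1(1) Sv12])
      show "fps_X * (fps_const b1 + fps_X * B1 oo fps_X * g1) * g1 = 1 - v1"
        unfolding sub1(3)[symmetric] by (simp only: mult_ac)
    qed
    show "g1 * (1 - fps_X * (fps_const b2 + fps_X * B2 oo fps_X * g2)) = 1"
    proof (rule cross[OF _ g1_def g2_def sub2(1)])
      show "fps_X * (fps_const b2 + fps_X * B2 oo fps_X * g2) * g2 = 1 - v2"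
        unfolding sub2(3)[symmetric] by (simp only: mult_ac)
      show "S * v2 * v1 = v2 + v1 - v2 * v1"
        using Sv12 by (simp only: mult_ac add_ac)
    qed
  qed
  \<comment> \<open>The inverse for \<open>u\<close> is the one for \<open>u1\<close> composed with
    the subordination function, hence \<open>psd_compose\<close> applies.\<close>
  then have "psd (g1 * (moment_fps (fps_X * u1) oo (fps_X * g1)))"
    by (intro psd_compose psd sub1)
  then show ?thesis
    by (simp only: sub1 S_def)
qed

text \<open>Likewise, the relation between \<open>u\<close> and \<open>u'\<close> reads \<open>1 / u' = 1 + t * (1 / u - 1)\<close>.\<close>

lemma psd_free_power:
  fixes u u' :: "real fps"
  assumes u: "u $ 0 = 1" "u' $ 0 = 1" and t: "1 \<le> t"
    and eq: "u = u' * (u + fps_const t * (1 - u))"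
    and psd: "psd (moment_fps (fps_X * u))"
  shows "psd (moment_fps (fps_X * u'))"
proof -
  define S where "S = moment_fps (fps_X * u')"
  let ?D = "fps_X * S"
  define v v' where "v = u oo ?D" and "v' = u' oo ?D"
  define g where "g = S * v"
  have S0: "S $ 0 = 1"
    unfolding S_def using u by (intro moment_fps_0) auto
  have Sv': "S * v' = 1"
    unfolding S_def v'_def using u(2) by (rule moment_fps_reciprocal)
  have D0: "?D $ 0 = 0" by simp
  have "v = v' * (v + fps_const t * (1 - v))"
    using arg_cong[OF eq, of "\<lambda>f. f oo ?D"] unfolding v_def v'_def
    by (simp only: fps_compose_mult_distrib[OF D0] fps_compose_add_distrib fps_compose_sub_distrib
        fps_const_compose fps_compose_1)
  from arg_cong[OF this, of "\<lambda>x. S * x"]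
  have "S * v = S * v' * (v + fps_const t * (1 - v))"
    by (simp only: mult.assoc)
  then have g: "g = v + fps_const t * (1 - v)"
    by (simp only: g_def Sv' mult_1_left)
  obtain b B where e: "self_energy (moment_fps (fps_X * u)) B b"
    by (rule self_energy_exists[OF moment_fps_0[of "fps_X * u"]]) (use u in auto)
  note sub = subordination[OF u(1) S0 e, folded v_def, folded g_def]
  let ?e = "(fps_const b + fps_X * B) oo (fps_X * g)"
  have "psd g"
  proof (rule psd_subordination_power)
    show "psd B"
      using self_energy.psd_B[OF e] psd by auto
    show "g $ 0 = 1" by (rule sub)
    \<comment> \<open>This is where \<open>1 <= t\<close> enters.\<close>
    show "0 \<le> t - 1" using t by simp
    have "g * (1 - fps_X * (fps_const (t - 1) * ?e)) = g - fps_const (t - 1) * (fps_X * g * ?e)"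
      by (simp add: algebra_simps)
    \<comment> \<open>As \<open>g\<close> is v + t * (1 - v), subtracting (t - 1) * (1 - v) leaves v
      + (1 - v).\<close>
    also have "\<dots> = 1"
      unfolding sub(3) by (subst g) (simp add: algebra_simps flip: fps_const_sub)
    finally show "g * (1 - fps_X * (fps_const (t - 1) * ?e)) = 1" .
  qed
  then have "psd (g * (moment_fps (fps_X * u) oo (fps_X * g)))"
    by (intro psd_compose psd sub)
  then show ?thesis
    by (simp only: sub S_def)
qed

text \<open>Inverses compose in reverse order; a factor \<open>fps_X\<close> is split off from each
  of them.\<close>

lemma moment_fps_compose:
  fixes f1 f2 :: "real fps"
  assumes "f1 $ 0 = 0" "f1 $ 1 = 1" "f2 $ 0 = 0" "f2 $ 1 = 1"
  shows "moment_fps (f2 oo f1) = moment_fps f2 * (moment_fps f1 oo (fps_X * moment_fps f2))"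
proof (rule moment_fps_unique)
  let ?D1 = "fps_X * moment_fps f1" and ?D2 = "fps_X * moment_fps f2"
  show "(f2 oo f1) $ 0 = 0" "(f2 oo f1) $ 1 = 1"
    using assms by (simp_all add: fps_compose_nth)
  have "(f2 oo f1) oo (?D1 oo ?D2) = f2 oo (f1 oo (?D1 oo ?D2))"
    using assms by (intro fps_compose_assoc[symmetric]) (simp_all add: fps_compose_nth)
  also have "f1 oo (?D1 oo ?D2) = (f1 oo ?D1) oo ?D2"
    by (rule fps_compose_assoc) simp_all
  also have "\<dots> = ?D2"
    unfolding compose_moment_fps[OF assms(1,2)] by simp
  also have "f2 oo ?D2 = fps_X"
    by (rule compose_moment_fps[OF assms(3,4)])
  also have "?D1 oo ?D2 = fps_X * (moment_fps f2 * (moment_fps f1 oo ?D2))"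
    by (simp add: fps_compose_mult_distrib mult.assoc)
  finally show "(f2 oo f1) oo (fps_X * (moment_fps f2 * (moment_fps f1 oo ?D2))) = fps_X" .
qed

text \<open>The bridge to measures. From positivity to a distribution, clearing denominators in F(D)
  = z gives an algebraic equation for D, hence the exponential bound that enters the moment
  problem.\<close>

lemma F_dist_iff: "F \<in> F_dist \<longleftrightarrow> F \<in> F_class \<and> psd (moment_fps (rf_taylor F))"
proof (cases "F \<in> F_class")
  case True
  let ?f = "rf_taylor F"
  let ?S = "moment_fps ?f"
  have "moment_seq F = fps_nth ?S"
    by (simp add: fun_eq_iff moment_seq_def moment_fps_def)
  then have "positive_definite_seq (moment_seq F) \<longleftrightarrow> positive_definite_seq (fps_nth ?S)"
    by simp
  also have "\<dots> \<longleftrightarrow> psd ?S"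
  proof
    assume "positive_definite_seq (fps_nth ?S)"
    then show "psd ?S"
      by (auto dest: positive_definite_seqD simp: fps_nth_inverse)
  next
    assume psd: "psd ?S"
    obtain U where U: "U \<in> regular_at_0" "rf_taylor U $ 0 = 1" "?f = fps_X * rf_taylor U"
      "?f $ 0 = 0" "?f $ 1 = 1"
      using True by (rule F_classE)
    obtain p q where pq: "poly q 0 \<noteq> 0" "rf_taylor U = fps_of_poly p / fps_of_poly q"
      using U(1) by (rule regular_at_0_cases)
    define c where "c = poly q 0"
    have q0: "fps_of_poly q $ 0 \<noteq> 0"
      using pq(1) by (simp add: poly_0_coeff_0)
    have p0: "coeff p 0 = c"
      using U(2) q0 by (simp add: pq(2) fps_divide_unit field_simps poly_0_coeff_0 c_def)
    have "?f * fps_of_poly q = fps_X * fps_of_poly p * (inverse (fps_of_poly q) * fps_of_poly q)"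
      unfolding U(3) pq(2) by (simp only: fps_divide_unit[OF q0] mult_ac)
    then have eq: "?f * fps_of_poly q = fps_X * fps_of_poly p"
      by (simp only: inverse_mult_eq_1[OF q0] mult_1_right)
    let ?D = "fps_X * ?S"
    have "(?f oo ?D) * (fps_of_poly q oo ?D) = ?D * (fps_of_poly p oo ?D)"
      using arg_cong[OF eq, of "\<lambda>f. f oo ?D"] by (simp add: fps_compose_mult_distrib)
    then have eq': "?D * (fps_of_poly p oo ?D) = fps_X * (fps_of_poly q oo ?D)"
      by (simp only: compose_moment_fps[OF U(4,5)])
    define P Q where "P = smult (inverse c) p" and "Q = smult (inverse c) q"
    have smult: "fps_of_poly (smult a r) oo ?D = fps_const a * (fps_of_poly r oo ?D)" for a r
      by (simp only: fps_of_poly_smult fps_const_mult_apply_left)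
    have "?D * (fps_of_poly P oo ?D) = fps_const (inverse c) * (?D * (fps_of_poly p oo ?D))"
      unfolding P_def smult by (rule mult.left_commute)
    also have "\<dots> = fps_X * (fps_of_poly Q oo ?D)"
      unfolding eq' Q_def smult by (rule mult.left_commute)
    finally have PQ: "?D * (fps_of_poly P oo ?D) = fps_X * (fps_of_poly Q oo ?D)" .
    have P0: "coeff P 0 = 1"
      using p0 pq(1) by (simp add: P_def c_def)
    have D0: "?D $ 0 = 0" by simp
    obtain C M where M: "0 < M" and bound: "\<And>n. \<bar>?D $ n\<bar> \<le> C * M ^ n"
      using algebraic_inverse_bound[OF D0 P0 PQ] by blast
    \<comment> \<open>The moment of index \<open>n\<close> is the coefficient \<open>n + 1\<close>
      of D, which costs one factor \<open>M\<close>.\<close>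
    from bound[of "Suc _"] have "\<bar>?S $ n\<bar> \<le> (C * M) * M ^ n" for n
      by (simp add: mult.assoc)
    with psd moment_fps_0[OF U(4,5)] M show "positive_definite_seq (fps_nth ?S)"
      by (rule positive_definite_seqI)
  qed
  finally show ?thesis
    using True by (simp add: F_dist_def)
qed (simp add: F_dist_def)

section \<open>Closure under the three operations on rational functions\<close>

lemma rf_X_nonzero: "rf_X \<noteq> 0"
  by (simp add: rf_X_def)

lemma R_transform_rf_X_mult: "R_transform (rf_X * U) = inverse U - 1"
  using rf_X_nonzero by (simp add: R_transform_def divide_inverse flip: mult.assoc)

lemma free_power_in_F_dist:
  assumes "F \<in> F_dist" "1 \<le> t"
  shows "free_power F t \<in> F_dist"
proof -
  obtain U where U: "U \<in> regular_at_0" "rf_taylor U $ 0 = 1" "F = rf_X * U" "U \<noteq> 0"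
    "rf_taylor F = fps_X * rf_taylor U"
    using assms(1) unfolding F_dist_iff by (auto elim: F_classE)
  let ?u = "rf_taylor U"
  \<comment> \<open>\<open>V\<close> is 1 + t * R with R the R-transform of \<open>F\<close>; its
    value at 0 is 1, so \<open>inverse V\<close> takes the place of \<open>U\<close> for the free
    power.\<close>
  define V where "V = 1 + rf_const t * (inverse U - 1)"
  have "free_power F t = rf_X * inverse V"
    by (simp add: free_power_def R_transform_rf_X_mult U(3) V_def divide_inverse)
  have u0: "?u $ 0 \<noteq> 0" using U(2) by simp
  note inv = regular_at_0_inverse[OF U(1) u0] rf_taylor_inverse[OF U(1) u0]
  have V: "V \<in> regular_at_0" "rf_taylor V = 1 + fps_const t * (inverse ?u - 1)"
    by (simp_all add: V_def inv U rf_taylor_add rf_taylor_mult rf_taylor_diff rf_taylor_const rf_taylor_1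
      regular_at_0_add regular_at_0_mult regular_at_0_diff regular_at_0_const regular_at_0_1)
  have V0: "rf_taylor V $ 0 = 1"
    using U(2) by (simp add: V(2))
  then have V0': "rf_taylor V $ 0 \<noteq> 0" by simp
  note invV = regular_at_0_inverse[OF V(1) V0'] rf_taylor_inverse[OF V(1) V0']
  let ?u' = "inverse (rf_taylor V)"
  have u'0: "?u' $ 0 = 1" using V0 by simp
  have "psd (moment_fps (fps_X * ?u'))"
  proof (rule psd_free_power[OF U(2) u'0 assms(2)])
    have "?u + fps_const t * (1 - ?u) = ?u * rf_taylor V"
      unfolding V(2) using inverse_mult_eq_1'[OF u0] by (simp add: algebra_simps)
    then have "?u' * (?u + fps_const t * (1 - ?u)) = ?u * (rf_taylor V * ?u')"
      by (simp only: mult_ac)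
    then show "?u = ?u' * (?u + fps_const t * (1 - ?u))"
      by (simp only: inverse_mult_eq_1'[OF V0'] mult_1_right)
    show "psd (moment_fps (fps_X * ?u))"
      using assms(1) U(5) by (simp add: F_dist_iff)
  qed
  moreover have "rf_taylor (rf_X * inverse V) = fps_X * ?u'"
    by (simp add: rf_taylor_mult regular_at_0_X invV rf_taylor_X)
  moreover have "rf_X * inverse V \<in> F_class"
    unfolding F_class_iff using invV u'0 by (intro bexI[of _ "inverse V"]) auto
  ultimately show ?thesis
    by (simp add: F_dist_iff \<open>free_power F t = _\<close>)
qed

lemma free_add_in_F_dist:
  assumes "F \<in> F_dist" "G \<in> F_dist"
  shows "free_add F G \<in> F_dist"
proof -
  obtain U where U: "U \<in> regular_at_0" "rf_taylor U $ 0 = 1" "F = rf_X * U" "U \<noteq> 0"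
    "rf_taylor F = fps_X * rf_taylor U"
    using assms(1) unfolding F_dist_iff by (auto elim: F_classE)
  obtain W where W: "W \<in> regular_at_0" "rf_taylor W $ 0 = 1" "G = rf_X * W" "W \<noteq> 0"
    "rf_taylor G = fps_X * rf_taylor W"
    using assms(2) unfolding F_dist_iff by (auto elim: F_classE)
  let ?u = "rf_taylor U" and ?w = "rf_taylor W"
  define V where "V = inverse U + inverse W - 1"
  have "free_add F G = rf_X * inverse V"
    by (simp add: free_add_def R_transform_rf_X_mult U(3) W(3) V_def divide_inverse)
  have u0: "?u $ 0 \<noteq> 0" and w0: "?w $ 0 \<noteq> 0" using U(2) W(2) by simp_all
  note invU = regular_at_0_inverse[OF U(1) u0] rf_taylor_inverse[OF U(1) u0]
  note invW = regular_at_0_inverse[OF W(1) w0] rf_taylor_inverse[OF W(1) w0]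
  have V: "V \<in> regular_at_0" "rf_taylor V = inverse ?u + inverse ?w - 1"
    by (simp_all add: V_def invU invW rf_taylor_add rf_taylor_diff rf_taylor_1
      regular_at_0_add regular_at_0_diff regular_at_0_1)
  have V0: "rf_taylor V $ 0 = 1"
    using U(2) W(2) by (simp add: V(2))
  then have V0': "rf_taylor V $ 0 \<noteq> 0" by simp
  note invV = regular_at_0_inverse[OF V(1) V0'] rf_taylor_inverse[OF V(1) V0']
  let ?v = "inverse (rf_taylor V)"
  have v0: "?v $ 0 = 1" using V0 by simp
  have "psd (moment_fps (fps_X * ?v))"
  proof (rule psd_free_add[OF v0 U(2) W(2)])
    have "?u * ?w * rf_taylor V = (?u * inverse ?u) * ?w + (?w * inverse ?w) * ?u - ?u * ?w"
      unfolding V(2) by (simp only: ring_distribs mult_ac mult_1_right mult_1_left)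
    also have "\<dots> = ?u + ?w - ?u * ?w"
      by (simp only: inverse_mult_eq_1'[OF u0] inverse_mult_eq_1'[OF w0] mult_1_left add.commute)
    finally have "?u + ?w - ?u * ?w = ?u * ?w * rf_taylor V" ..
    from arg_cong[OF this, of "\<lambda>x. ?v * x"]
    have "?v * (?u + ?w - ?u * ?w) = ?u * ?w * (rf_taylor V * ?v)"
      by (simp only: mult_ac)
    then show "?u * ?w = ?v * (?u + ?w - ?u * ?w)"
      by (simp only: inverse_mult_eq_1'[OF V0'] mult_1_right)
    show "psd (moment_fps (fps_X * ?u))" "psd (moment_fps (fps_X * ?w))"
      using assms U(5) W(5) by (simp_all add: F_dist_iff)
  qed
  moreover have "rf_taylor (rf_X * inverse V) = fps_X * ?v"
    by (simp add: rf_taylor_mult regular_at_0_X invV rf_taylor_X)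
  moreover have "rf_X * inverse V \<in> F_class"
    unfolding F_class_iff using invV v0 by (intro bexI[of _ "inverse V"]) auto
  ultimately show "free_add F G \<in> F_dist"
    by (simp add: F_dist_iff \<open>free_add F G = _\<close>)
qed

text \<open>A numerator vanishing at 0 supplies the factor w. In this form membership is visibly
  stable under composition.\<close>

lemma F_class_iff_taylor:
  "F \<in> F_class \<longleftrightarrow> F \<in> regular_at_0 \<and> rf_taylor F $ 0 = 0 \<and> rf_taylor F $ 1 = 1"
proof
  assume *: "F \<in> regular_at_0 \<and> rf_taylor F $ 0 = 0 \<and> rf_taylor F $ 1 = 1"
  then have "F \<in> regular_at_0" by blast
  then obtain p q where pq: "F = to_fract p / to_fract q" "poly q 0 \<noteq> 0"
    "rf_taylor F = fps_of_poly p / fps_of_poly q"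
    by (rule regular_at_0_cases)
  have "coeff p 0 = 0"
    using * pq(2) unfolding pq(3) by (simp add: fps_divide_unit poly_0_coeff_0)
  then obtain p' where p': "p = [:0, 1:] * p'"
    by (cases p) (simp add: coeff_pCons)
  define U where "U = to_fract p' / to_fract q"
  have F: "F = rf_X * U"
    by (simp add: pq(1) p' U_def rf_X_def del: mult_pCons_left)
  have U: "U \<in> regular_at_0"
    unfolding U_def using pq(2) by (rule regular_at_0_fraction)
  have "rf_taylor F = fps_X * rf_taylor U"
    unfolding F by (simp add: rf_taylor_mult regular_at_0_X U rf_taylor_X)
  then have "rf_taylor U $ 0 = 1"
    using * by simp
  with U F show "F \<in> F_class"
    by (auto simp: F_class_iff)
qed (auto elim: F_classE)

lemma rf_compose_in_F_dist:
  assumes "F \<in> F_dist" "G \<in> F_dist"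
  shows "rf_compose F G \<in> F_dist"
proof -
  let ?f = "rf_taylor F" and ?g = "rf_taylor G"
  have F: "F \<in> regular_at_0" "?f $ 0 = 0" "?f $ 1 = 1" "psd (moment_fps ?f)"
    and G: "G \<in> regular_at_0" "?g $ 0 = 0" "?g $ 1 = 1" "psd (moment_fps ?g)"
    using assms by (simp_all add: F_dist_iff F_class_iff_taylor)
  have "psd (moment_fps (?f oo ?g))"
    unfolding moment_fps_compose[OF G(2,3) F(2,3)]
    by (intro psd_compose F G moment_fps_0)
  moreover have "(?f oo ?g) $ 0 = 0" "(?f oo ?g) $ 1 = 1"
    using F G by (simp_all add: fps_compose_nth)
  ultimately show ?thesis
    by (simp add: F_dist_iff F_class_iff_taylor rf_taylor_compose regular_at_0_compose F G)
qed

section \<open>Units and monoid laws\<close>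

lemma rf_X_in_F_dist: "rf_X \<in> F_dist"
proof -
  \<comment> \<open>The moments are those of the point mass at 0.\<close>
  have "moment_fps fps_X = 1"
    by (rule moment_fps_unique) auto
  moreover have "psd 1"
    unfolding psd_def psd_upto_def
  proof (intro allI)
    fix N and a :: "nat \<Rightarrow> real"
    have "(\<Sum>i\<le>N. \<Sum>j\<le>N. a i * a j * 1 $ (i + j)) = (\<Sum>i\<in>{0}. \<Sum>j\<in>{0}. a i * a j * 1 $ (i + j))"
      by (intro sum.mono_neutral_cong_right ballI sum.neutral) auto
    then show "0 \<le> (\<Sum>i\<le>N. \<Sum>j\<le>N. a i * a j * 1 $ (i + j))"
      by simp
  qed
  ultimately show ?thesis
    by (simp add: F_dist_iff F_class_iff_taylor rf_taylor_X regular_at_0_X)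
qed

lemma R_transform_free_add:
  assumes "F \<in> F_dist" "G \<in> F_dist"
  shows "R_transform (free_add F G) = R_transform F + R_transform G"
proof -
  define V where "V = 1 + R_transform F + R_transform G"
  have "free_add F G = rf_X * inverse V"
    by (simp only: free_add_def V_def divide_inverse)
  then have "R_transform (free_add F G) = V - 1"
    by (simp add: R_transform_rf_X_mult)
  also have "\<dots> = R_transform F + R_transform G"
    by (simp add: V_def)
  finally show ?thesis .
qed

lemma R_transform_rf_X: "R_transform rf_X = 0"
  by (simp add: R_transform_def rf_X_def)

lemma rf_X_over_R_transform:
  assumes "F \<in> F_dist"
  shows "rf_X / (1 + R_transform F) = F"
proof -
  have "F \<noteq> 0"
    using assms rf_X_nonzero unfolding F_dist_iff by (auto elim!: F_classE)
  then show ?thesis by (simp add: R_transform_def rf_X_nonzero)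
qed

text \<open>The R-transform turns free convolution into addition and determines its argument, so the
  laws are those of addition.\<close>

lemma monoid_free_add: "Group.monoid \<lparr>carrier = F_dist, monoid.mult = free_add, one = rf_X\<rparr>"
  by (rule Group.monoidI)
    (simp_all add: free_add_in_F_dist rf_X_in_F_dist R_transform_free_add R_transform_rf_X
      rf_X_over_R_transform free_add_def[of "free_add _ _"] free_add_def[of _ "free_add _ _"]
      free_add_def[of rf_X] free_add_def[of _ rf_X] add.assoc)

text \<open>Each law is an equality of functions regular at 0, checked on Taylor series, where
  composition is associative with unit \<open>fps_X\<close>.\<close>

lemma monoid_rf_compose: "Group.monoid \<lparr>carrier = F_dist, monoid.mult = rf_compose, one = rf_X\<rparr>"
proof (rule Group.monoidI)
  have F_dist: "F \<in> regular_at_0" "rf_taylor F $ 0 = 0" if "F \<in> F_dist" for F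
    using that by (simp_all add: F_dist_iff F_class_iff_taylor)
  note reg = F_dist regular_at_0_compose regular_at_0_X
  note taylor = rf_taylor_compose rf_taylor_X reg
  fix F G H
  let ?M = "\<lparr>carrier = F_dist, monoid.mult = rf_compose, one = rf_X\<rparr>"
  assume "F \<in> carrier ?M" "G \<in> carrier ?M" "H \<in> carrier ?M"
  then have FGH: "F \<in> F_dist" "G \<in> F_dist" "H \<in> F_dist" by simp_all
  have "rf_compose (rf_compose F G) H = rf_compose F (rf_compose G H)"
    by (rule rf_taylor_inject) (simp_all add: taylor FGH fps_compose_assoc)
  then show "F \<otimes>\<^bsub>?M\<^esub> G \<otimes>\<^bsub>?M\<^esub> H = F \<otimes>\<^bsub>?M\<^esub> (G \<otimes>\<^bsub>?M\<^esub> H)"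
    by simp
next
  fix F assume "F \<in> carrier \<lparr>carrier = F_dist, monoid.mult = rf_compose, one = rf_X\<rparr>"
  then have F: "F \<in> regular_at_0" "rf_taylor F $ 0 = 0"
    by (simp_all add: F_dist_iff F_class_iff_taylor)
  have "rf_compose rf_X F = F"
    by (rule rf_taylor_inject)
      (simp_all add: F rf_taylor_compose rf_taylor_X regular_at_0_compose regular_at_0_X)
  then show "\<one>\<^bsub>\<lparr>carrier = F_dist, monoid.mult = rf_compose, one = rf_X\<rparr>\<^esub>
      \<otimes>\<^bsub>\<lparr>carrier = F_dist, monoid.mult = rf_compose, one = rf_X\<rparr>\<^esub> F = F" by simp
  have "rf_compose F rf_X = F"
    by (rule rf_taylor_inject)
      (simp_all add: F rf_taylor_compose rf_taylor_X regular_at_0_compose regular_at_0_X)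
  then show "F \<otimes>\<^bsub>\<lparr>carrier = F_dist, monoid.mult = rf_compose, one = rf_X\<rparr>\<^esub>
      \<one>\<^bsub>\<lparr>carrier = F_dist, monoid.mult = rf_compose, one = rf_X\<rparr>\<^esub> = F" by simp
qed (simp_all add: rf_compose_in_F_dist rf_X_in_F_dist)

theorem corollary3p2:
  shows "(\<forall>F \<in> F_dist. \<forall>t :: real. t \<ge> 1 \<longrightarrow> free_power F t \<in> F_dist) \<and>
         (\<forall>F\<^sub>1 \<in> F_dist. \<forall>F\<^sub>2 \<in> F_dist.
            free_add F\<^sub>1 F\<^sub>2 \<in> F_dist \<and> rf_compose F\<^sub>2 F\<^sub>1 \<in> F_dist) \<and>
         Group.monoid \<lparr>carrier = F_dist, monoid.mult = free_add, one = rf_X\<rparr> \<and>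
         Group.monoid \<lparr>carrier = F_dist, monoid.mult = rf_compose, one = rf_X\<rparr>"
  by (intro conjI ballI allI impI free_power_in_F_dist free_add_in_F_dist rf_compose_in_F_dist
      monoid_free_add monoid_rf_compose)

end
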